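(* Let $n\geq 2$ and let $\gamma_0,\gamma_1,\ldots,\gamma_n$ be $n+1$ roots of the root system $\Phi=\Phi_{(n,v)}$ of type $\widetilde A_n$ with parameter $v$, regarded as coordinate column vectors with respect to the ordered basis $\alpha_0,\alpha_1,\ldots,\alpha_n$ of simple roots. Let $d:=\det(\gamma_0,\gamma_1,\ldots,\gamma_n)$ be the determinant of the $(n+1)\times(n+1)$ matrix with these columns. Then $d$ is either $0$ or of the form $$\mu\, v^{l}(v-v^{-1})^{m-1}\prod_{k=1}^{m}c_{h_k}$$ where $\mu\in\{1,-1\}$, $l\in\mathbb{Z}$, $m\geq 1$ is an integer and $h_1,\ldots,h_m$ are positive integers. Further, if $n=2$ and $d\neq 0$, then $d$ is of this form with $m=1$; while if $n\geq 3$, there exist roots $\gamma_0,\ldots,\gamma_n\in\Phi$ for which $d$ is of the form displayed above with $m>1$.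
   Context: Here $v$ is either a positive real number, with $A=\mathbb{R}$, or an indeterminate, with $A=\mathbb{R}[v,v^{-1}]$ (the generic case). Let $V$ be the free $A$-module with basis $\alpha_0,\alpha_1,\ldots,\alpha_n$ ($n\geq2$). Define $a_{ij}=(\alpha_i,\alpha_j^\vee)\in A$ for $0\le i,j\le n$ by $a_{ii}=2$; $a_{01}=-v$, $a_{10}=-v^{-1}$; $a_{i,i+1}=a_{i+1,i}=-1$ for $1\le i\le n-1$; $a_{n0}=-v$, $a_{0n}=-v^{-1}$; and $a_{ij}=0$ otherwise. Let $s_{\alpha_j}:V\to V$ be the $A$-linear map with $s_{\alpha_j}(\alpha_i)=\alpha_i-a_{ij}\alpha_j$, and let $W$ be the group generated by $s_{\alpha_0},\ldots,s_{\alpha_n}$ (a Coxeter group of type $\widetilde A_n$). The set of roots is $\Phi=\Phi_{(n,v)}=\{w(\alpha_i)\mid w\in W,\ 0\le i\le n\}$. For $k\in\mathbb{Z}$, $c_k:=\frac{v^k-v^{-k}}{v-v^{-1}}$ if $v\neq1$, and $c_k:=k$ if $v=1$; so $c_k=v^{k-1}+v^{k-3}+\cdots+v^{-k+1}$ for $k>0$. *)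

theory Defs
  imports "Jordan_Normal_Form.Determinant" "HOL-Algebra.Generated_Groups" "HOL-Library.Poly_Mapping"
begin

text \<open>
  The group ring of the integers over the reals, i.e. the ring of Laurent polynomials in one
  indeterminate with real coefficients; multiplication of finitely supported maps is convolution.
\<close>

type_synonym laurent_poly = "int \<Rightarrow>\<^sub>0 real"

definition laurent_var :: laurent_poly
  where "laurent_var = Poly_Mapping.single 1 1"

text \<open>
  The quotient of \<open>a\<close> by \<open>b\<close> inside the ring, meaningful if \<open>b\<close> is nonzero and divides \<open>a\<close>.
  It allows the same definitions to be used for the field of reals and for Laurent polynomials.
\<close>

definition quot :: "'a::idom \<Rightarrow> 'a \<Rightarrow> 'a"
  where "quot a b = (THE x. x * b = a)"

lemma quot_eqI: "b \<noteq> 0 \<Longrightarrow> x * b = a \<Longrightarrow> quot a b = x"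
  unfolding quot_def by (rule the_equality) auto

lemma quot_field [simp]: "(b::'a::field) \<noteq> 0 \<Longrightarrow> quot a b = a / b"
  by (rule quot_eqI) auto

definition zpow :: "'a::idom \<Rightarrow> int \<Rightarrow> 'a"
  where "zpow v k = (if k \<ge> 0 then v ^ nat k else (quot 1 v) ^ nat (- k))"

lemma zpow_field: "(v::'a::field) \<noteq> 0 \<Longrightarrow> zpow v k = v powi k"
  by (simp add: zpow_def power_int_def inverse_eq_divide)

lemma quot_laurent_var: "quot 1 laurent_var = Poly_Mapping.single (- 1) 1"
proof (rule quot_eqI)
  show "laurent_var \<noteq> 0"
    unfolding laurent_var_def by (metis lookup_single_eq lookup_zero zero_neq_one)
  show "Poly_Mapping.single (- 1) 1 * laurent_var = 1"
    unfolding laurent_var_def by (simp add: mult_single)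
qed

lemma zpow_laurent_var: "zpow laurent_var k = Poly_Mapping.single k 1"
proof -
  have "Poly_Mapping.single a (1::real) ^ m = Poly_Mapping.single (int m * a) 1" for a m
    by (induction m) (simp_all add: mult_single algebra_simps)
  then show ?thesis
    by (simp add: zpow_def quot_laurent_var) (simp add: laurent_var_def)
qed

definition c_coeff :: "'a::idom \<Rightarrow> int \<Rightarrow> 'a"
  where "c_coeff v k =
    (if v = 1 then of_int k else quot (zpow v k - zpow v (- k)) (v - zpow v (- 1)))"

definition cartan :: "nat \<Rightarrow> 'a::idom \<Rightarrow> nat \<Rightarrow> nat \<Rightarrow> 'a"
  where "cartan n v i j =
    (if i = j then 2
     else if i = 0 \<and> j = 1 then - v
     else if i = 1 \<and> j = 0 then - zpow v (- 1)
     else if i = n \<and> j = 0 then - v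
     else if i = 0 \<and> j = n then - zpow v (- 1)
     else if 1 \<le> i \<and> i < n \<and> j = i + 1 then - 1
     else if 1 \<le> j \<and> j < n \<and> i = j + 1 then - 1
     else 0)"

text \<open>
  \<open>V\<close> is the module of column vectors of dimension \<open>n + 1\<close>, and linear maps are matrices with
  respect to the basis of simple roots.
\<close>

definition simple_root :: "nat \<Rightarrow> nat \<Rightarrow> 'a::idom vec"
  where "simple_root n i = unit_vec (n + 1) i"

definition simple_reflection :: "nat \<Rightarrow> 'a::idom \<Rightarrow> nat \<Rightarrow> 'a mat"
  where "simple_reflection n v j =
    mat_of_cols (n + 1)
      (map (\<lambda>i. simple_root n i - cartan n v i j \<cdot>\<^sub>v simple_root n j) [0..<n + 1])"

lemma mat_mult_simple_root:
  assumes A: "A \<in> carrier_mat (n + 1) (n + 1)" and i: "i < n + 1"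
  shows "A *\<^sub>v simple_root n i = col A i"
proof -
  have "col A i = col (A * 1\<^sub>m (n + 1)) i"
    using A by simp
  also have "\<dots> = A *\<^sub>v col (1\<^sub>m (n + 1)) i"
    using A i by (intro col_mult2) auto
  finally show ?thesis
    using i by (simp add: simple_root_def)
qed

lemma simple_reflection_simple_root:
  assumes "i \<le> n"
  shows "simple_reflection n v j *\<^sub>v simple_root n i =
    simple_root n i - cartan n v i j \<cdot>\<^sub>v simple_root n j"
proof -
  let ?c = "map (\<lambda>i. simple_root n i - cartan n v i j \<cdot>\<^sub>v simple_root n j) [0..<n + 1]"
  have M: "simple_reflection n v j \<in> carrier_mat (n + 1) (n + 1)"
    unfolding simple_reflection_def by (simp add: carrier_matI)
  have "simple_reflection n v j *\<^sub>v simple_root n i = col (simple_reflection n v j) i"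
    using M assms by (intro mat_mult_simple_root) auto
  also have "\<dots> = ?c ! i"
    unfolding simple_reflection_def
    by (rule col_mat_of_cols) (use assms in \<open>auto simp: simple_root_def simp del: upt_Suc\<close>)
  also have "\<dots> = simple_root n i - cartan n v i j \<cdot>\<^sub>v simple_root n j"
    using assms by (simp del: upt_Suc)
  finally show ?thesis .
qed

definition GL :: "'a::idom itself \<Rightarrow> nat \<Rightarrow> 'a mat monoid"
  where "GL ty k = units_of (ring_mat ty k ())"

lemma simple_reflection_in_GL:
  assumes j: "j \<le> n"
  shows "simple_reflection n v j \<in> carrier (GL TYPE('a::idom) (n + 1))"
proof -
  let ?S = "simple_reflection n v j"
  have S: "?S \<in> carrier_mat (n + 1) (n + 1)"
    unfolding simple_reflection_def by (simp add: carrier_matI)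
  have a: "(simple_root n i :: 'a vec) \<in> carrier_vec (n + 1)" for i
    unfolding simple_root_def by simp
  have smult: "?S *\<^sub>v (k \<cdot>\<^sub>v simple_root n i) = k \<cdot>\<^sub>v (?S *\<^sub>v simple_root n i)" for k i
    using S a[of i] by (intro eq_vecI) (auto intro!: scalar_prod_smult_distrib row_carrier_vec)
  have "?S * ?S = 1\<^sub>m (n + 1)"
  proof (rule mat_col_eqI)
    fix i assume "i < dim_col (1\<^sub>m (n + 1) :: 'a mat)"
    then have i: "i < n + 1" by simp
    have "col (?S * ?S) i = ?S *\<^sub>v col ?S i"
      using S i by (intro col_mult2) auto
    also have "col ?S i = ?S *\<^sub>v simple_root n i"
      using S i by (intro mat_mult_simple_root[symmetric]) auto
    also have "\<dots> = simple_root n i - cartan n v i j \<cdot>\<^sub>v simple_root n j"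
      using i by (intro simple_reflection_simple_root) auto
    also have "?S *\<^sub>v \<dots> =
        ?S *\<^sub>v simple_root n i - cartan n v i j \<cdot>\<^sub>v (?S *\<^sub>v simple_root n j)"
      using a by (simp add: mult_minus_distrib_mat_vec[OF S] smult)
    also have "?S *\<^sub>v simple_root n i = simple_root n i - cartan n v i j \<cdot>\<^sub>v simple_root n j"
      using i by (intro simple_reflection_simple_root) auto
    also have "?S *\<^sub>v simple_root n j = simple_root n j - cartan n v j j \<cdot>\<^sub>v simple_root n j"
      using j by (rule simple_reflection_simple_root)
    also have "simple_root n i - cartan n v i j \<cdot>\<^sub>v simple_root n j
        - cartan n v i j \<cdot>\<^sub>v (simple_root n j - cartan n v j j \<cdot>\<^sub>v simple_root n j) = simple_root n i"
      using a by (intro eq_vecI) (auto simp: cartan_def[of n v j j] algebra_simps simple_root_def)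
    also have "\<dots> = col (1\<^sub>m (n + 1)) i"
      using i by (simp add: simple_root_def)
    finally show "col (?S * ?S) i = col (1\<^sub>m (n + 1)) i" .
  qed (use S in auto)
  then show ?thesis
    using S unfolding GL_def units_of_def Units_def ring_mat_def by auto
qed

definition weyl_group :: "nat \<Rightarrow> 'a::idom \<Rightarrow> 'a mat set"
  where "weyl_group n v =
    generate (GL TYPE('a) (n + 1)) (simple_reflection n v ` {0..n})"

definition roots :: "nat \<Rightarrow> 'a::idom \<Rightarrow> 'a vec set"
  where "roots n v = {w *\<^sub>v simple_root n i | w i. w \<in> weyl_group n v \<and> i \<le> n}"

definition root_det :: "nat \<Rightarrow> (nat \<Rightarrow> 'a::idom vec) \<Rightarrow> 'a"
  where "root_det n \<gamma> = det (mat_of_cols (n + 1) (map \<gamma> [0..<n + 1]))"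

definition has_det_form :: "'a::idom \<Rightarrow> nat \<Rightarrow> 'a \<Rightarrow> bool"
  where "has_det_form v m d \<longleftrightarrow>
    (\<exists>\<mu> \<in> {1, - 1}. \<exists>l::int. \<exists>h::nat \<Rightarrow> int. (\<forall>k \<in> {1..m}. h k > 0) \<and>
      d = \<mu> * zpow v l * (v - zpow v (- 1)) ^ (m - 1) * (\<Prod>k = 1..m. c_coeff v (h k)))"

end

theory Submission
  imports Defs
begin

text \<open>
  In suitable coordinates every root is a vector \<open>v\<^sup>a e\<^sub>p - v\<^sup>b e\<^sub>q\<close> with \<open>p \<noteq> q\<close> and \<open>a \<equiv> b\<close> modulo 2, i.e. an
  edge of a gain graph on \<open>n + 1\<close> vertices, and the coordinate change has determinant
  \<open>v\<^sup>-\<^sup>1 - v\<close>. Expanding the determinant of \<open>n + 1\<close> edges along one column contracts that edge. An edge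
  that becomes a loop contributes a factor \<open>v\<^sup>x - v\<^sup>y\<close> with \<open>x \<equiv> y\<close> modulo 2, which is zero or, up to
  sign and a power of \<open>v\<close>, equal to \<open>v\<^sup>h - v\<^sup>-\<^sup>h = (v - v\<^sup>-\<^sup>1) c\<^sub>h\<close> with \<open>h > 0\<close>. A nonzero determinant
  is therefore a signed monomial times such factors, one for each cycle of the graph, and division by \<open>v\<^sup>-\<^sup>1 - v\<close> gives
  the generic case. The coordinate change is singular at \<open>v = 1\<close>, so the case of a real \<open>v\<close> is
  obtained by specializing the generic one.
\<close>

subsection \<open>Laurent monomials and products of cycle factors\<close>

abbreviation X :: "int \<Rightarrow> laurent_poly"
  where "X \<equiv> zpow laurent_var"

lemma X_mult: "X a * X b = X (a + b)"
  by (simp add: zpow_laurent_var mult_single)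

lemma X_mult_left: "X a * (X b * y) = X (a + b) * y"
  by (simp add: X_mult flip: mult.assoc)

lemma X_0 [simp]: "X 0 = 1"
  by (simp add: zpow_laurent_var)

lemma X_1: "X 1 = laurent_var"
  by (simp only: zpow_laurent_var) (simp add: laurent_var_def)

lemma X_1_mult: "laurent_var * X a = X (1 + a)" "X a * laurent_var = X (a + 1)"
  by (metis X_1 X_mult)+

lemma X_inject [simp]: "X a = X b \<longleftrightarrow> a = b"
  by (metis lookup_single_eq lookup_single_not_eq zero_neq_one zpow_laurent_var)

text \<open>The index counts cycle factors. They are kept as \<open>X h - X (- h)\<close>, not in
  terms of \<open>c_coeff\<close>, so that no quotient occurs while determinants are expanded;
  \<open>cyc_form_product\<close> translates at the end.\<close>

inductive cyc_form :: "nat \<Rightarrow> laurent_poly \<Rightarrow> bool" where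
  unit: "\<mu> \<in> {1, - 1} \<Longrightarrow> cyc_form 0 (\<mu> * X l)"
| cycle: "h > 0 \<Longrightarrow> cyc_form m x \<Longrightarrow> cyc_form (Suc m) ((X h - X (- h)) * x)"

lemma cyc_form_X: "cyc_form 0 (X l)"
  using unit[of 1 l] by simp

lemma cyc_form_minus: "cyc_form m x \<Longrightarrow> cyc_form m (- x)"
proof (induction rule: cyc_form.induct)
  case (unit \<mu> l)
  then have "- \<mu> \<in> {1, - 1}" by auto
  from cyc_form.unit[OF this, of l] show ?case by simp
next
  case (cycle h m x)
  from cyc_form.cycle[OF cycle(1,3)] show ?case by simp
qed

lemma cyc_form_X_mult: "cyc_form m x \<Longrightarrow> cyc_form m (X a * x)"
proof (induction rule: cyc_form.induct)
  case (unit \<mu> l)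
  then show ?case using cyc_form_minus[OF cyc_form_X] by (auto simp: X_mult intro: cyc_form_X)
next
  case (cycle h m x)
  from cyc_form.cycle[OF cycle(1,3)] show ?case by (simp add: mult.left_commute)
qed

lemma cyc_form_mult: "cyc_form m x \<Longrightarrow> cyc_form k y \<Longrightarrow> cyc_form (m + k) (x * y)"
proof (induction rule: cyc_form.induct)
  case (unit \<mu> l)
  then show ?case using cyc_form_X_mult[of k y l] cyc_form_minus[of k "X l * y"] by auto
next
  case (cycle h m x)
  from cyc_form.cycle[OF cycle(1) cycle(3)[OF cycle(4)]] show ?case by (simp add: mult.assoc)
qed

lemma cyc_form_sign: "cyc_form m x \<Longrightarrow> cyc_form m ((- 1) ^ p * x)"
  by (cases "even p") (auto intro: cyc_form_minus)

definition cyc_form_le :: "nat \<Rightarrow> laurent_poly \<Rightarrow> bool"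
  where "cyc_form_le k x \<longleftrightarrow> x = 0 \<or> (\<exists>m\<le>k. cyc_form m x)"

definition cyc_form0 :: "laurent_poly \<Rightarrow> bool"
  where "cyc_form0 x \<longleftrightarrow> (\<exists>k. cyc_form_le k x)"

lemma cyc_form_leI: "cyc_form m x \<Longrightarrow> m \<le> k \<Longrightarrow> cyc_form_le k x"
  by (auto simp: cyc_form_le_def)

lemma cyc_form_le_0 [simp]: "cyc_form_le k 0"
  by (simp add: cyc_form_le_def)

lemma cyc_form_le_X [simp]: "cyc_form_le k (X a)"
  by (rule cyc_form_leI[OF cyc_form_X]) simp

lemma cyc_form_le_minus: "cyc_form_le k x \<Longrightarrow> cyc_form_le k (- x)"
  by (auto simp: cyc_form_le_def intro: cyc_form_minus)

lemma cyc_form_le_minus_iff [simp]: "cyc_form_le k (- x) \<longleftrightarrow> cyc_form_le k x"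
  using cyc_form_le_minus[of k x] cyc_form_le_minus[of k "- x"] by auto

lemma cyc_form_le_sign: "cyc_form_le k x \<Longrightarrow> cyc_form_le k ((- 1) ^ p * x)"
  by (auto simp: cyc_form_le_def intro: cyc_form_sign)

lemma cyc_form_le_mult: "cyc_form_le k x \<Longrightarrow> cyc_form_le l y \<Longrightarrow> cyc_form_le (k + l) (x * y)"
  unfolding cyc_form_le_def by (metis add_mono cyc_form_mult mult_zero_left mult_zero_right)

lemma cyc_form_le_X_mult: "cyc_form_le k x \<Longrightarrow> cyc_form_le k (X a * x)"
  by (auto simp: cyc_form_le_def intro: cyc_form_X_mult)

lemma cyc_form0_0 [simp]: "cyc_form0 0"
  by (simp add: cyc_form0_def)

lemma cyc_form0_X [simp]: "cyc_form0 (X a)" "cyc_form0 (- X a)"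
  by (simp_all add: cyc_form0_def)

lemma cyc_form0_X_mult: "cyc_form0 x \<Longrightarrow> cyc_form0 (X a * x)"
  by (auto simp: cyc_form0_def intro: cyc_form_le_X_mult)

lemma cyc_form0_sign: "cyc_form0 x \<Longrightarrow> cyc_form0 ((- 1) ^ p * x)"
  by (auto simp: cyc_form0_def intro: cyc_form_le_sign)

lemma cyc_form0_mult: "cyc_form0 x \<Longrightarrow> cyc_form0 y \<Longrightarrow> cyc_form0 (x * y)"
  by (auto simp: cyc_form0_def intro: cyc_form_le_mult)

lemma cyc_form_le_imp_0: "cyc_form_le k x \<Longrightarrow> cyc_form0 x"
  by (auto simp: cyc_form0_def)

text \<open>If \<open>a - b = 2 * h\<close>, then \<open>X (b + h)\<close> factors out and leaves
  \<open>X h - X (- h)\<close>; equal parity makes the midpoint \<open>b + h\<close> an integer. The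
  case \<open>a = b\<close> gives zero, and \<open>a < b\<close> follows by a change of
  sign.\<close>

lemma cyc_form_le_diff:
  assumes "even (a - b)"
  shows "cyc_form_le (Suc k) (X a - X b)"
proof -
  have pos: "cyc_form_le (Suc k) (X a - X b)" if gt: "a > b" and ev: "even (a - b)" for a b
  proof -
    from ev obtain h where h: "a - b = 2 * h" by (elim evenE)
    with gt have "h > 0" by simp
    from cyc_form.cycle[OF this cyc_form_X, of "b + h"]
    have "cyc_form (Suc 0) (X (h + (b + h)) - X (- h + (b + h)))"
      by (simp only: left_diff_distrib X_mult)
    also have "h + (b + h) = a" using h by simp
    also have "- h + (b + h) = b" by simp
    finally have "cyc_form (Suc 0) (X a - X b)" .
    then show ?thesis by (rule cyc_form_leI) simp
  qed
  show ?thesis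
  proof (cases a b rule: linorder_cases)
    case less
    have "even (b - a)" using assms by presburger
    from pos[OF less this] show ?thesis
      using cyc_form_le_minus[of "Suc k" "X b - X a"] by simp
  qed (use pos assms in auto)
qed

subsection \<open>Determinants of matrices with edge columns\<close>

text \<open>Laplace expansion along column 0. Matrices are given by their columns
  \<open>c j\<close>; \<open>insert_index p\<close> is the injection of row numbers that skips
  \<open>p\<close>.\<close>

lemma det_single_entry_column:
  fixes c :: "nat \<Rightarrow> nat \<Rightarrow> 'a::comm_ring_1"
  assumes p: "p < Suc N" and c: "\<And>i. i < Suc N \<Longrightarrow> i \<noteq> p \<Longrightarrow> c 0 i = 0"
  shows "det (mat (Suc N) (Suc N) (\<lambda>(i, j). c j i)) =
    (- 1) ^ p * c 0 p * det (mat N N (\<lambda>(i, j). c (Suc j) (insert_index p i)))"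
    (is "det ?A = _ * _ * det ?B")
proof -
  have A: "?A \<in> carrier_mat (Suc N) (Suc N)" by simp
  have "det ?A = (\<Sum>i<Suc N. ?A $$ (i, 0) * cofactor ?A i 0)"
    using A by (rule laplace_expansion_column) simp
  also have "\<dots> = (\<Sum>i<Suc N. if i = p then ?A $$ (p, 0) * cofactor ?A p 0 else 0)"
    using c by (intro sum.cong) auto
  also have "\<dots> = c 0 p * cofactor ?A p 0"
    using p by (subst sum.delta) auto
  also have "mat_delete ?A p 0 = ?B"
    using p by (intro eq_matI) (auto simp: mat_delete_def insert_index_def)
  ultimately show ?thesis by (simp add: cofactor_def mult_ac)
qed

text \<open>
  Contraction of the edge \<open>{p, q}\<close> that is column \<open>0\<close>: adding \<open>k\<close> times row \<open>p\<close> to row \<open>q\<close>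
  clears the column except for its entry in row \<open>p\<close>.
\<close>

lemma det_pivot:
  fixes c :: "nat \<Rightarrow> nat \<Rightarrow> 'a::comm_ring_1"
  assumes p: "p < Suc N" and q: "q < Suc N" "p \<noteq> q"
    and c: "\<And>i. i < Suc N \<Longrightarrow> i \<noteq> p \<Longrightarrow> i \<noteq> q \<Longrightarrow> c 0 i = 0"
    and k: "k * c 0 p + c 0 q = 0"
  shows "det (mat (Suc N) (Suc N) (\<lambda>(i, j). c j i)) = (- 1) ^ p * c 0 p *
    det (mat N N (\<lambda>(i, j). (if insert_index p i = q then k * c (Suc j) p else 0)
      + c (Suc j) (insert_index p i)))"
    (is "det ?A = _")
proof -
  let ?c = "\<lambda>j i. (if i = q then k * c j p else 0) + c j i"
  have "det ?A = det (addrow k q p ?A)"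
    using p q by (intro det_addrow[symmetric]) auto
  also have "addrow k q p ?A = mat (Suc N) (Suc N) (\<lambda>(i, j). ?c j i)"
    using p by (intro eq_matI) (auto simp: mat_addrow_gen_def)
  also have "det \<dots> = (- 1) ^ p * ?c 0 p *
      det (mat N N (\<lambda>(i, j). ?c (Suc j) (insert_index p i)))"
    using p c k by (intro det_single_entry_column) auto
  finally show ?thesis using q by simp
qed

section \<open>Edges and spokes under contraction and deletion of a vertex\<close>

definition spoke :: "nat \<Rightarrow> laurent_poly \<Rightarrow> nat \<Rightarrow> laurent_poly"
  where "spoke p g i = (if i = p then g else 0)"

definition edge :: "nat \<Rightarrow> nat \<Rightarrow> int \<Rightarrow> int \<Rightarrow> nat \<Rightarrow> laurent_poly"
  where "edge p q a b i = (if i = p then X a else if i = q then - X b else 0)"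

definition is_edge :: "nat \<Rightarrow> (nat \<Rightarrow> laurent_poly) \<Rightarrow> bool"
  where "is_edge N f \<longleftrightarrow> (\<exists>p q a b. p < N \<and> q < N \<and> p \<noteq> q \<and> even (a - b) \<and>
    (\<forall>i<N. f i = edge p q a b i))"

text \<open>A spoke models a loop or an edge that has lost one end. Since \<open>g\<close> may be
  zero and \<open>p\<close> may lie outside the matrix, a zero column is a spoke too.\<close>

definition is_spoke :: "nat \<Rightarrow> (nat \<Rightarrow> laurent_poly) \<Rightarrow> bool"
  where "is_spoke N f \<longleftrightarrow> (\<exists>p g. cyc_form0 g \<and> (\<forall>i<N. f i = spoke p g i))"

text \<open>After the removal of row \<open>p\<close>, \<open>insert_index p\<close> sends new row
  numbers to old ones and \<open>delete_index p\<close> sends them back.\<close>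

lemma insert_index_eq_iff: "p' \<noteq> p \<Longrightarrow> insert_index p i = p' \<longleftrightarrow> i = delete_index p p'"
  using insert_delete_index[of p' p] delete_insert_index[of p i] by metis

lemma insert_index_less: "i < N \<Longrightarrow> insert_index p i < Suc N"
  by (simp add: insert_index_def)

lemma insert_index_neq [simp]: "insert_index p i \<noteq> p"
  by (simp add: insert_index_def)

lemma delete_index_less: "p' \<noteq> p \<Longrightarrow> p' < Suc N \<Longrightarrow> p < Suc N \<Longrightarrow> delete_index p p' < N"
  by (auto simp: delete_index_def)

lemma delete_index_neq: "p' \<noteq> p \<Longrightarrow> q' \<noteq> p \<Longrightarrow> p' \<noteq> q' \<Longrightarrow> delete_index p p' \<noteq> delete_index p q'"
  by (metis insert_delete_index)

text \<open>Row \<open>p\<close> is about to disappear, so \<open>f\<close> is prescribed off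
  \<open>p\<close> only. This makes the lemma fit both contractions and deletions of a
  vertex.\<close>

lemma is_edge_delete:
  assumes "p' < Suc N" "q' < Suc N" "p' \<noteq> q'" "p' \<noteq> p" "q' \<noteq> p" "p < Suc N" "even (a - b)"
    and "\<And>i. i < Suc N \<Longrightarrow> i \<noteq> p \<Longrightarrow> f i = edge p' q' a b i"
  shows "is_edge N (\<lambda>i. f (insert_index p i))"
  unfolding is_edge_def
  apply (rule exI[of _ "delete_index p p'"], rule exI[of _ "delete_index p q'"])
  apply (rule exI[of _ a], rule exI[of _ b])
  using assms
  by (auto simp: edge_def delete_index_less delete_index_neq insert_index_less insert_index_eq_iff)

lemma spoke_delete:
  assumes "p' \<noteq> p" and "\<And>i. i < Suc N \<Longrightarrow> i \<noteq> p \<Longrightarrow> f i = spoke p' g i" and "i < N"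
  shows "f (insert_index p i) = spoke (delete_index p p') g i"
  using assms by (auto simp: spoke_def insert_index_less insert_index_eq_iff)

lemma is_spoke_delete:
  assumes "p' \<noteq> p" "cyc_form0 g" and "\<And>i. i < Suc N \<Longrightarrow> i \<noteq> p \<Longrightarrow> f i = spoke p' g i"
  shows "is_spoke N (\<lambda>i. f (insert_index p i))"
  unfolding is_spoke_def using assms spoke_delete[of p' p N f g] by blast

text \<open>Row \<open>p\<close> is merged into row \<open>q\<close>: an end at \<open>p\<close>
  moves to \<open>q\<close> with its exponent shifted by the even number \<open>b - a\<close>, so
  parity survives. An edge with the same two ends, in either orientation, becomes a loop at
  \<open>q\<close> whose coefficient is a difference of two monomials of equal parity.\<close>

lemma is_edge_contract:
  assumes f: "is_edge (Suc N) f" and p: "p < Suc N" "q < Suc N" "p \<noteq> q" and ev: "even (a - b)"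
  defines "f' \<equiv> \<lambda>i. (if i = q then X (b - a) * f p else 0) + f i"
  shows "is_edge N (\<lambda>i. f' (insert_index p i)) \<or>
    (\<exists>g. cyc_form_le 1 g \<and> (\<forall>i<N. f' (insert_index p i) = spoke (delete_index p q) g i))"
proof -
  from f obtain p' q' a' b' where e: "p' < Suc N" "q' < Suc N" "p' \<noteq> q'" "even (a' - b')"
    and f: "\<And>i. i < Suc N \<Longrightarrow> f i = edge p' q' a' b' i"
    unfolding is_edge_def by blast
  have f': "f' i = (if i = q then X (b - a) * edge p' q' a' b' p else 0) + edge p' q' a' b' i"
    if "i < Suc N" for i
    using that f p by (simp add: f'_def)
  consider (fst) "p' = p" "q' \<noteq> q" | (snd) "q' = p" "p' \<noteq> q" | (par) "p' = p" "q' = q"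
    | (opp) "p' = q" "q' = p" | (none) "p' \<noteq> p" "q' \<noteq> p"
    by blast
  then show ?thesis
  proof cases
    case fst
    have "is_edge N (\<lambda>i. f' (insert_index p i))"
      by (rule is_edge_delete[of q N q' p "b - a + a'" b'])
        (use fst e p ev f' in \<open>auto simp: edge_def X_mult\<close>)
    then show ?thesis ..
  next
    case snd
    have "is_edge N (\<lambda>i. f' (insert_index p i))"
      by (rule is_edge_delete[of p' N q p a' "b - a + b'"])
        (use snd e p ev f' in \<open>auto simp: edge_def X_mult\<close>)
    then show ?thesis ..
  next
    case par
    have "\<forall>i<N. f' (insert_index p i) = spoke (delete_index p q) (X (b - a + a') - X b') i"
      by (intro allI impI spoke_delete)
        (use par e p f' in \<open>auto simp: edge_def spoke_def X_mult\<close>)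
    moreover have "cyc_form_le 1 (X (b - a + a') - X b')"
      unfolding One_nat_def by (rule cyc_form_le_diff) (use ev e in auto)
    ultimately show ?thesis by blast
  next
    case opp
    have "\<forall>i<N. f' (insert_index p i) = spoke (delete_index p q) (X a' - X (b - a + b')) i"
      by (intro allI impI spoke_delete)
        (use opp e p f' in \<open>auto simp: edge_def spoke_def X_mult\<close>)
    moreover have "cyc_form_le 1 (X a' - X (b - a + b'))"
      unfolding One_nat_def by (rule cyc_form_le_diff) (use ev e in auto)
    ultimately show ?thesis by blast
  next
    case none
    have "is_edge N (\<lambda>i. f' (insert_index p i))"
      by (rule is_edge_delete[of p' N q' p a' b'])
        (use none e p f' in \<open>auto simp: edge_def\<close>)
    then show ?thesis ..
  qed
qed

lemma is_spoke_contract: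
  assumes f: "is_spoke (Suc N) f" and p: "p < Suc N" "q < Suc N" "p \<noteq> q"
  shows "is_spoke N (\<lambda>i. (if insert_index p i = q then X k * f p else 0) + f (insert_index p i))"
proof -
  from f obtain p' g where g: "cyc_form0 g" and f: "\<And>i. i < Suc N \<Longrightarrow> f i = spoke p' g i"
    unfolding is_spoke_def by blast
  show ?thesis
  proof (cases "p' = p")
    case True
    then show ?thesis
      by (intro is_spoke_delete[of q p "X k * g"]) (use p f g in \<open>auto simp: spoke_def cyc_form0_X_mult\<close>)
  next
    case False
    then show ?thesis
      by (intro is_spoke_delete[of p' p g]) (use p f g in \<open>auto simp: spoke_def\<close>)
  qed
qed

text \<open>If one end is deleted, the other remains as a spoke whose coefficient is a monomial up
  to sign, so no cycle factor arises.\<close>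

lemma is_edge_delete_vertex:
  assumes f: "is_edge (Suc N) f" and p: "p < Suc N"
  shows "is_edge N (\<lambda>i. f (insert_index p i)) \<or> is_spoke N (\<lambda>i. f (insert_index p i))"
proof -
  from f obtain p' q' a' b' where e: "p' < Suc N" "q' < Suc N" "p' \<noteq> q'" "even (a' - b')"
    and f: "\<And>i. i < Suc N \<Longrightarrow> f i = edge p' q' a' b' i"
    unfolding is_edge_def by blast
  consider "p' = p" | "q' = p" | "p' \<noteq> p" "q' \<noteq> p" by blast
  then show ?thesis
  proof cases
    case 1
    then have "is_spoke N (\<lambda>i. f (insert_index p i))"
      by (intro is_spoke_delete[of q' p "- X b'"]) (use e f in \<open>auto simp: spoke_def edge_def\<close>)
    then show ?thesis ..
  next
    case 2
    then have "is_spoke N (\<lambda>i. f (insert_index p i))"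
      by (intro is_spoke_delete[of p' p "X a'"]) (use e f in \<open>auto simp: spoke_def edge_def\<close>)
    then show ?thesis ..
  next
    case 3
    then have "is_edge N (\<lambda>i. f (insert_index p i))"
      by (intro is_edge_delete[of p' N q' p a' b']) (use e p f in auto)
    then show ?thesis ..
  qed
qed

lemma is_spoke_delete_vertex:
  assumes f: "is_spoke (Suc N) f"
  shows "is_spoke N (\<lambda>i. f (insert_index p i))"
proof -
  from f obtain p' g where g: "cyc_form0 g" and f: "\<And>i. i < Suc N \<Longrightarrow> f i = spoke p' g i"
    unfolding is_spoke_def by blast
  show ?thesis
  proof (cases "p' = p")
    case True
    \<comment> \<open>The only possibly nonzero entry was in the deleted row.\<close>
    then have "f (insert_index p i) = spoke 0 0 i" if "i < N" for i
      using that f by (simp add: insert_index_less spoke_def)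
    then show ?thesis unfolding is_spoke_def using cyc_form0_0 by blast
  next
    case False
    then show ?thesis by (intro is_spoke_delete[of p' p g]) (use f g in auto)
  qed
qed

text \<open>Induction on the number of vertices, eliminating column 0: an edge is contracted, and
  the vertex of a spoke is deleted at the cost of its coefficient. Both operations turn edges and
  spokes into edges and spokes.\<close>

lemma det_edges_spokes:
  assumes "\<And>j. j < N \<Longrightarrow> is_edge N (c j) \<or> is_spoke N (c j)"
  shows "cyc_form0 (det (mat N N (\<lambda>(i, j). c j i)))"
  using assms
proof (induction N arbitrary: c)
  case 0
  have "cyc_form0 1" using cyc_form0_X(1)[of 0] by simp
  then show ?case by (simp add: det_dim_zero)
next
  case (Suc N)
  from Suc.prems[of 0] consider "is_edge (Suc N) (c 0)" | "is_spoke (Suc N) (c 0)" by auto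
  then show ?case
  proof cases
    case 1
    then obtain p q a b where e: "p < Suc N" "q < Suc N" "p \<noteq> q" "even (a - b)"
      and c0: "\<And>i. i < Suc N \<Longrightarrow> c 0 i = edge p q a b i"
      unfolding is_edge_def by blast
    let ?c = "\<lambda>j i. (if insert_index p i = q then X (b - a) * c (Suc j) p else 0)
      + c (Suc j) (insert_index p i)"
    have "is_edge N (?c j) \<or> is_spoke N (?c j)" if "j < N" for j
    proof (cases "is_edge (Suc N) (c (Suc j))")
      case True
      from is_edge_contract[OF this e] show ?thesis
        unfolding is_spoke_def by (blast intro: cyc_form_le_imp_0)
    next
      case False
      with Suc.prems[of "Suc j"] that have "is_spoke (Suc N) (c (Suc j))" by auto
      from is_spoke_contract[OF this e(1-3)] show ?thesis by blast
    qed
    from Suc.IH[of ?c, OF this] have IH: "cyc_form0 (det (mat N N (\<lambda>(i, j). ?c j i)))" .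
    have "det (mat (Suc N) (Suc N) (\<lambda>(i, j). c j i)) =
        (- 1) ^ p * c 0 p * det (mat N N (\<lambda>(i, j). ?c j i))"
      by (rule det_pivot) (use e c0 in \<open>auto simp: edge_def X_mult\<close>)
    moreover have "c 0 p = X a" using e c0 by (simp add: edge_def)
    ultimately show ?thesis
      using cyc_form0_sign[OF cyc_form0_X_mult[OF IH]] by (simp add: mult.assoc)
  next
    case 2
    then obtain p g where g: "cyc_form0 g" and c0: "\<And>i. i < Suc N \<Longrightarrow> c 0 i = spoke p g i"
      unfolding is_spoke_def by blast
    \<comment> \<open>A spoke outside the matrix is a zero column; any row, here 0, then serves for
      the expansion and contributes the entry 0.\<close>
    define p' where "p' = (if p < Suc N then p else 0)"
    let ?c = "\<lambda>j i. c (Suc j) (insert_index p' i)"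
    have p': "p' < Suc N" by (simp add: p'_def)
    have "is_edge N (?c j) \<or> is_spoke N (?c j)" if "j < N" for j
      using Suc.prems[of "Suc j"] that is_edge_delete_vertex[OF _ p'] is_spoke_delete_vertex by blast
    from Suc.IH[of ?c, OF this] have IH: "cyc_form0 (det (mat N N (\<lambda>(i, j). ?c j i)))" .
    have "det (mat (Suc N) (Suc N) (\<lambda>(i, j). c j i)) =
        (- 1) ^ p' * c 0 p' * det (mat N N (\<lambda>(i, j). ?c j i))"
      by (rule det_single_entry_column) (use p' c0 in \<open>auto simp: p'_def spoke_def split: if_splits\<close>)
    moreover have "cyc_form0 (c 0 p')" using p' c0 g by (simp add: spoke_def)
    ultimately show ?thesis
      using cyc_form0_sign[OF cyc_form0_mult[OF _ IH]] by (simp add: mult.assoc)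
  qed
qed

section \<open>Three edges on three vertices\<close>

lemma det_mat_2:
  "det (mat 2 2 (\<lambda>(i, j). c j i)) = c 0 0 * c 1 1 - c 0 1 * c 1 (0::nat)"
  for c :: "nat \<Rightarrow> nat \<Rightarrow> 'a::comm_ring_1"
  by (subst laplace_expansion_column[of _ 2 0])
    (auto simp: cofactor_def mat_delete_def det_single numeral_2_eq_2)

text \<open>A column on two vertices, the merged vertex listed first. The sign \<open>s\<close>
  absorbs the orientation of an edge; the second alternative is a loop at the merged vertex.\<close>

definition column_pair :: "laurent_poly \<Rightarrow> laurent_poly \<Rightarrow> bool"
  where "column_pair x y \<longleftrightarrow>
    (\<exists>s\<in>{1, - 1}. \<exists>a b. even (a - b) \<and> x = s * X a \<and> y = - s * X b) \<or> cyc_form_le 1 x \<and> y = 0"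

text \<open>Two loops give 0, a loop and an edge give the loop coefficient times a signed monomial,
  and two edges form a 2-cycle with value \<open>X (b + a') - X (a + b')\<close> up to sign.\<close>

lemma column_pair_det:
  assumes "column_pair x y" "column_pair x' y'"
  shows "cyc_form_le 1 (x * y' - y * x')"
proof -
  have X: "cyc_form_le 1 (X a * z)" "cyc_form_le 1 (z * X a)" if "cyc_form_le 1 z" for a z
    using cyc_form_le_X_mult[OF that, of a] by (simp_all add: mult.commute)
  consider (spokes) "y = 0" "y' = 0"
    | (spoke1) s b where "y = 0" "cyc_form_le 1 x" "s \<in> {1, - 1}" "y' = - s * X b"
    | (spoke2) s b where "y' = 0" "cyc_form_le 1 x'" "s \<in> {1, - 1}" "y = - s * X b"
    | (edges) s a b s' a' b' where "s \<in> {1, - 1}" "even (a - b)" "x = s * X a" "y = - s * X b"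
        "s' \<in> {1, - 1}" "even (a' - b')" "x' = s' * X a'" "y' = - s' * X b'"
    using assms unfolding column_pair_def by blast
  then show ?thesis
  proof cases
    case spokes
    then show ?thesis by simp
  next
    case spoke1
    then show ?thesis using X by auto
  next
    case spoke2
    then show ?thesis using X by auto
  next
    case edges
    from edges(2,6) have "even ((b + a') - (a + b'))" by simp
    then have "cyc_form_le 1 (X (b + a') - X (a + b'))"
      unfolding One_nat_def by (rule cyc_form_le_diff)
    then have "cyc_form_le 1 ((s * s') * (X (b + a') - X (a + b')))"
      using edges(1,5) cyc_form_le_minus[of 1 "X (b + a') - X (a + b')"] by auto
    also have "(s * s') * (X (b + a') - X (a + b')) = x * y' - y * x'"
      unfolding edges by (simp add: algebra_simps flip: X_mult)
    finally show ?thesis .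
  qed
qed

text \<open>
  Contracting one of three edges leaves two vertices, and every loop then sits at the merged
  vertex \<open>r\<close>. Two loops are therefore proportional, so that at most one cycle contributes.
\<close>

lemma det_edges_3:
  assumes e: "\<And>j. j < 3 \<Longrightarrow> is_edge 3 (c j)"
  shows "cyc_form_le 1 (det (mat 3 3 (\<lambda>(i, j). c j i)))"
proof -
  have N: "3 = Suc 2" by simp
  from e[of 0] obtain p q a b where e0: "p < Suc 2" "q < Suc 2" "p \<noteq> q" "even (a - b)"
      and c0: "\<And>i. i < Suc 2 \<Longrightarrow> c 0 i = edge p q a b i"
    unfolding is_edge_def N[symmetric] by auto
  let ?c = "\<lambda>j i. (if insert_index p i = q then X (b - a) * c (Suc j) p else 0)
      + c (Suc j) (insert_index p i)"
  define r where "r = delete_index p q"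
  have r: "r < 2" unfolding r_def using e0 by (intro delete_index_less) auto
  define r' where "r' = 1 - r"
  have r': "r' < 2" "r' \<noteq> r" "r = 0 \<and> r' = 1 \<or> r = 1 \<and> r' = 0" using r by (cases r; auto simp: r'_def)+
  have pair: "column_pair (?c j r) (?c j r')" if j: "j < 2" for j
  proof -
    have "is_edge 2 (?c j) \<or> (\<exists>g. cyc_form_le 1 g \<and> (\<forall>i<2. ?c j i = spoke r g i))"
      unfolding r_def by (rule is_edge_contract) (use e[of "Suc j"] e0 j in auto)
    then show ?thesis
    proof
      assume "is_edge 2 (?c j)"
      then obtain p' q' a' b' where e': "p' < 2" "q' < 2" "p' \<noteq> q'" "even (a' - b')"
        and f: "\<And>i. i < 2 \<Longrightarrow> ?c j i = edge p' q' a' b' i"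
        unfolding is_edge_def by blast
      have "p' = r \<and> q' = r' \<or> p' = r' \<and> q' = r" using e' r' by auto
      then show ?thesis
      proof
        assume "p' = r \<and> q' = r'"
        then have "?c j r = 1 * X a'" "?c j r' = - 1 * X b'"
          using f r r' by (simp_all add: edge_def)
        with e'(4) show ?thesis unfolding column_pair_def by blast
      next
        assume "p' = r' \<and> q' = r"
        then have "?c j r = - 1 * X b'" "?c j r' = - (- 1) * X a'"
          using f r r' by (simp_all add: edge_def)
        moreover have "even (b' - a')" using e'(4) by simp
        ultimately show ?thesis unfolding column_pair_def by blast
      qed
    next
      assume "\<exists>g. cyc_form_le 1 g \<and> (\<forall>i<2. ?c j i = spoke r g i)"
      then obtain g where "cyc_form_le 1 g" "\<And>i. i < 2 \<Longrightarrow> ?c j i = spoke r g i" by blast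
      then have "cyc_form_le 1 (?c j r) \<and> ?c j r' = 0" using r r' by (simp add: spoke_def)
      then show ?thesis unfolding column_pair_def by blast
    qed
  qed
  have "cyc_form_le 1 (?c 0 r * ?c 1 r' - ?c 0 r' * ?c 1 r)"
    by (rule column_pair_det[OF pair[of 0] pair[of 1]]) simp_all
  then have two: "cyc_form_le 1 (det (mat 2 2 (\<lambda>(i, j). ?c j i)))"
    unfolding det_mat_2 using r'(3) cyc_form_le_minus[of 1 "?c 0 r * ?c 1 r' - ?c 0 r' * ?c 1 r"]
    by (elim disjE conjE) (simp_all only: minus_diff_eq)
  have "det (mat 3 3 (\<lambda>(i, j). c j i)) =
      (- 1) ^ p * c 0 p * det (mat 2 2 (\<lambda>(i, j). ?c j i))"
    unfolding N by (rule det_pivot) (use e0 c0 in \<open>auto simp: edge_def X_mult\<close>)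
  moreover have "c 0 p = X a" using e0 c0 by (simp add: edge_def)
  ultimately show ?thesis
    using cyc_form_le_sign[OF cyc_form_le_X_mult[OF two]] by (simp only: mult.assoc)
qed

subsection \<open>Reflections and roots\<close>

definition pairing :: "nat \<Rightarrow> 'a::idom \<Rightarrow> nat \<Rightarrow> 'a vec \<Rightarrow> 'a"
  where "pairing n v j x = (\<Sum>k<n + 1. cartan n v k j * x $ k)"

lemma simple_reflection_carrier [simp]:
  "simple_reflection n v j \<in> carrier_mat (n + 1) (n + 1)"
  "simple_reflection n v j \<in> carrier_mat (Suc n) (Suc n)"
  unfolding simple_reflection_def by (simp_all add: carrier_matI)

lemma simple_reflection_dim [simp]:
  "dim_row (simple_reflection n v j) = n + 1" "dim_col (simple_reflection n v j) = n + 1"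
  using simple_reflection_carrier(1)[of n v j] by (simp_all del: simple_reflection_carrier)

lemma simple_root_carrier [simp]:
  "simple_root n i \<in> carrier_vec (n + 1)" "simple_root n i \<in> carrier_vec (Suc n)"
  by (simp_all add: simple_root_def)

lemma simple_reflection_index:
  assumes "i \<le> n" "k \<le> n"
  shows "simple_reflection n v j $$ (i, k) =
    (if i = k then 1 else 0) - (if i = j then cartan n v k j else 0)"
  using assms unfolding simple_reflection_def
  by (subst mat_of_cols_index) (auto simp: simple_root_def unit_vec_def simp del: upt_Suc)

lemma simple_reflection_mult_vec:
  assumes x: "x \<in> carrier_vec (n + 1)" and i: "i \<le> n"
  shows "(simple_reflection n v j *\<^sub>v x) $ i = x $ i - (if i = j then pairing n v j x else 0)"
proof -
  have "(simple_reflection n v j *\<^sub>v x) $ i =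
      (\<Sum>k<n + 1. simple_reflection n v j $$ (i, k) * x $ k)"
    using x i by (simp add: scalar_prod_def lessThan_atLeast0)
  also have "\<dots> = (\<Sum>k<n + 1. (if i = k then x $ k else 0)
      - (if i = j then cartan n v k j * x $ k else 0))"
    using i by (intro sum.cong) (auto simp: simple_reflection_index left_diff_distrib)
  also have "\<dots> = x $ i - (if i = j then pairing n v j x else 0)"
    using i by (simp add: sum_subtractf pairing_def del: sum.lessThan_Suc)
  finally show ?thesis .
qed

text \<open>Since \<open>alpha_j\<close> pairs to 2 with its own coroot, the reflection negates the
  pairing, and the second correction undoes the first.\<close>

lemma simple_reflection_involution:
  assumes x: "x \<in> carrier_vec (n + 1)" and j: "j \<le> n"
  shows "simple_reflection n v j *\<^sub>v (simple_reflection n v j *\<^sub>v x) = x"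
proof -
  let ?S = "simple_reflection n v j" and ?p = "pairing n v j x"
  have Sx: "?S *\<^sub>v x \<in> carrier_vec (n + 1)"
    using x by (intro mult_mat_vec_carrier) auto
  have "pairing n v j (?S *\<^sub>v x) =
      (\<Sum>k<n + 1. cartan n v k j * x $ k - (if k = j then 2 * ?p else 0))"
    unfolding pairing_def[of n v j "?S *\<^sub>v x"]
    by (intro sum.cong)
      (auto simp: simple_reflection_mult_vec[OF x] right_diff_distrib cartan_def[of n v j j]
        simp del: index_mult_mat_vec)
  also have "\<dots> = - ?p"
    using j by (simp add: sum_subtractf pairing_def del: sum.lessThan_Suc)
  finally have "pairing n v j (?S *\<^sub>v x) = - ?p" .
  with x Sx show ?thesis
    by (intro eq_vecI) (auto simp: simple_reflection_mult_vec simp del: index_mult_mat_vec)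
qed

lemma simple_reflection_square:
  assumes "j \<le> n"
  shows "simple_reflection n v j * simple_reflection n v j = 1\<^sub>m (n + 1)"
    (is "?S * ?S = _")
proof (rule mat_col_eqI)
  fix i assume "i < dim_col (1\<^sub>m (n + 1) :: 'a mat)"
  then have i: "i < n + 1" by simp
  have "col (?S * ?S) i = ?S *\<^sub>v col ?S i"
    using i by (intro col_mult2) auto
  also have "col ?S i = ?S *\<^sub>v simple_root n i"
    using i by (intro mat_mult_simple_root[symmetric]) auto
  also have "?S *\<^sub>v \<dots> = col (1\<^sub>m (n + 1)) i"
    using i assms by (simp add: simple_reflection_involution simple_root_def)
  finally show "col (?S * ?S) i = col (1\<^sub>m (n + 1)) i" .
qed simp_all

section \<open>The Weyl group and induction over roots\<close>

lemma GL_mult: "mult (GL ty k) = (*)" and GL_one: "one (GL ty k) = 1\<^sub>m k"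
  by (simp_all add: GL_def units_of_def ring_mat_simps)

lemma group_GL: "group (GL TYPE('a::idom) k)"
  unfolding GL_def by (intro monoid.units_group ring.is_monoid ring_mat)

lemma inv_simple_reflection:
  assumes "j \<le> n"
  shows "inv\<^bsub>GL TYPE('a::idom) (n + 1)\<^esub> (simple_reflection n v j) = simple_reflection n (v::'a) j"
  using simple_reflection_in_GL[OF assms, of v] simple_reflection_square[OF assms, of v]
  by (intro group.inv_equality[OF group_GL]) (auto simp: GL_mult GL_one)

text \<open>Generators are their own inverses, so closure of \<open>P\<close> under simple
  reflections covers inverses too. The dimension of \<open>w\<close> is carried along for the
  associativity of the matrix-vector product.\<close>

lemma weyl_group_invariant:
  assumes w: "w \<in> weyl_group n v"
    and P: "\<And>x j. x \<in> carrier_vec (n + 1) \<Longrightarrow> j \<le> n \<Longrightarrow> P x \<Longrightarrow> P (simple_reflection n v j *\<^sub>v x)"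
  shows "w \<in> carrier_mat (n + 1) (n + 1) \<and> (\<forall>x\<in>carrier_vec (n + 1). P x \<longrightarrow> P (w *\<^sub>v x))"
  using w unfolding weyl_group_def
proof (induction rule: generate.induct)
  case one
  then show ?case by (simp add: GL_one)
next
  case (incl h)
  then show ?case using P by auto
next
  case (inv h)
  then show ?case using P by (auto simp: inv_simple_reflection[simplified])
next
  case (eng h1 h2)
  have "(h1 * h2) *\<^sub>v x = h1 *\<^sub>v (h2 *\<^sub>v x)" if "x \<in> carrier_vec (n + 1)" for x
    using eng.IH that by (intro assoc_mult_mat_vec) auto
  with eng.IH show ?case
    by (auto simp: GL_mult simp del: index_mult_mat_vec intro: mult_mat_vec_carrier mult_carrier_mat)
qed

lemma weyl_group_carrier: "w \<in> weyl_group n v \<Longrightarrow> w \<in> carrier_mat (n + 1) (n + 1)"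
  using weyl_group_invariant[of w n v "\<lambda>_. True"] by simp

lemma roots_carrier: "x \<in> roots n v \<Longrightarrow> x \<in> carrier_vec (n + 1)"
  unfolding roots_def using weyl_group_carrier by (fastforce intro: mult_mat_vec_carrier)

text \<open>Reduces claims about whole orbits to simple roots and one reflection; it serves to write
  roots as edges, to specialize them and to lift them.\<close>

lemma roots_induct [consumes 1, case_names simple reflection]:
  assumes x: "x \<in> roots n v"
    and simple: "\<And>i. i \<le> n \<Longrightarrow> P (simple_root n i)"
    and reflection: "\<And>x j. x \<in> carrier_vec (n + 1) \<Longrightarrow> j \<le> n \<Longrightarrow> P x \<Longrightarrow>
      P (simple_reflection n v j *\<^sub>v x)"
  shows "P x"
proof -
  from x obtain w i where "x = w *\<^sub>v simple_root n i" "w \<in> weyl_group n v" "i \<le> n"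
    unfolding roots_def by blast
  with weyl_group_invariant[of w n v P] simple reflection show ?thesis by simp
qed

lemma simple_root_in_roots:
  assumes "i \<le> n"
  shows "simple_root n i \<in> roots n v"
proof -
  have "1\<^sub>m (n + 1) \<in> weyl_group n v"
    unfolding weyl_group_def GL_one[of "TYPE('a)", symmetric] by (rule generate.one)
  moreover have "1\<^sub>m (n + 1) *\<^sub>v simple_root n i = (simple_root n i :: 'a vec)" by simp
  ultimately show ?thesis unfolding roots_def using assms by (metis (mono_tags, lifting) mem_Collect_eq)
qed

lemma reflection_in_roots:
  assumes x: "x \<in> roots n v" and j: "j \<le> n"
  shows "simple_reflection n v j *\<^sub>v x \<in> roots n v"
proof -
  let ?S = "simple_reflection n v j"
  from x obtain w i where x: "x = w *\<^sub>v simple_root n i" and w: "w \<in> weyl_group n v" and i: "i \<le> n"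
    unfolding roots_def by blast
  have "?S \<in> weyl_group n v"
    unfolding weyl_group_def using j by (intro generate.incl) auto
  then have "?S * w \<in> weyl_group n v"
    using w generate.eng[of ?S "GL TYPE('a) (n + 1)" _ w] unfolding weyl_group_def
    by (simp add: GL_mult)
  moreover have "?S *\<^sub>v x = (?S * w) *\<^sub>v simple_root n i"
    unfolding x using weyl_group_carrier[OF w] by (intro assoc_mult_mat_vec[symmetric]) auto
  ultimately show ?thesis unfolding roots_def using i by blast
qed

subsection \<open>Roots as edges\<close>

definition next_vertex :: "nat \<Rightarrow> nat \<Rightarrow> nat"
  where "next_vertex n i = (if i = n then 0 else i + 1)"

text \<open>
  The change of coordinates \<open>\<alpha>\<^sub>0 \<mapsto> v\<^sup>-\<^sup>1 e\<^sub>0 - v e\<^sub>1\<close>, \<open>\<alpha>\<^sub>i \<mapsto> e\<^sub>i - e\<^sub>i\<^sub>+\<^sub>1\<close> (indices modulo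
  \<open>n + 1\<close>). It turns the reflection in \<open>\<alpha>\<^sub>i\<close> into the transposition of \<open>e\<^sub>i\<close> and \<open>e\<^sub>i\<^sub>+\<^sub>1\<close>, up to
  scaling by \<open>v\<^sup>2\<close> and \<open>v\<^sup>-\<^sup>2\<close> for \<open>i = 0\<close>.
\<close>

definition edge_matrix :: "nat \<Rightarrow> laurent_poly mat"
  where "edge_matrix n = mat (n + 1) (n + 1) (\<lambda>(r, i).
    if i = 0 then edge 0 1 (- 1) 1 r else edge i (next_vertex n i) 0 0 r)"

lemma edge_matrix_carrier [simp]:
  "edge_matrix n \<in> carrier_mat (n + 1) (n + 1)"
  "edge_matrix n \<in> carrier_mat (Suc n) (Suc n)"
  by (simp_all add: edge_matrix_def)

lemma edge_matrix_index:
  "r \<le> n \<Longrightarrow> i \<le> n \<Longrightarrow> edge_matrix n $$ (r, i) =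
    (if i = 0 then edge 0 1 (- 1) 1 r else edge i (next_vertex n i) 0 0 r)"
  by (simp add: edge_matrix_def)

lemma edge_matrix_dim [simp]:
  "dim_row (edge_matrix n) = n + 1" "dim_col (edge_matrix n) = n + 1"
  by (simp_all add: edge_matrix_def)

text \<open>With the next lemma this identifies the coroots in edge coordinates:
  \<open>y_j - y_(j+1)\<close> for \<open>j >= 1\<close>, indices modulo \<open>n + 1\<close>, and
  \<open>v y_0 - v^-1 y_1\<close> for \<open>j = 0\<close>, with weights inverse to those of the
  root.\<close>

lemma cartan_edge_matrix:
  assumes "n \<ge> 2" "k \<le> n" "1 \<le> j" "j \<le> n"
  shows "cartan n laurent_var k j = edge_matrix n $$ (j, k) - edge_matrix n $$ (next_vertex n j, k)"
  using assms by (auto simp: cartan_def edge_matrix_def edge_def next_vertex_def X_1)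

lemma cartan_edge_matrix_0:
  assumes "n \<ge> 2" "k \<le> n"
  shows "cartan n laurent_var k 0 = X 1 * edge_matrix n $$ (0, k) - X (- 1) * edge_matrix n $$ (1, k)"
  using assms by (auto simp: cartan_def edge_matrix_def edge_def next_vertex_def X_mult X_1 X_1_mult)

lemma edge_matrix_mult_vec:
  assumes "x \<in> carrier_vec (n + 1)" "r \<le> n"
  shows "(edge_matrix n *\<^sub>v x) $ r = (\<Sum>k<n + 1. edge_matrix n $$ (r, k) * x $ k)"
  using assms by (simp add: scalar_prod_def lessThan_atLeast0)

lemma pairing_edge_matrix:
  assumes "n \<ge> 2" "x \<in> carrier_vec (n + 1)" "1 \<le> j" "j \<le> n"
  shows "pairing n laurent_var j x =
    (edge_matrix n *\<^sub>v x) $ j - (edge_matrix n *\<^sub>v x) $ next_vertex n j"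
proof -
  have "pairing n laurent_var j x =
    (\<Sum>k<n + 1. edge_matrix n $$ (j, k) * x $ k - edge_matrix n $$ (next_vertex n j, k) * x $ k)"
    unfolding pairing_def using assms
    by (intro sum.cong) (auto simp: cartan_edge_matrix left_diff_distrib)
  moreover have "next_vertex n j \<le> n" using assms by (auto simp: next_vertex_def)
  ultimately show ?thesis
    using assms by (simp add: edge_matrix_mult_vec sum_subtractf del: index_mult_mat_vec sum.lessThan_Suc)
qed

lemma pairing_edge_matrix_0:
  assumes "n \<ge> 2" "x \<in> carrier_vec (n + 1)"
  shows "pairing n laurent_var 0 x =
    X 1 * (edge_matrix n *\<^sub>v x) $ 0 - X (- 1) * (edge_matrix n *\<^sub>v x) $ 1"
proof -
  have "pairing n laurent_var 0 x = (\<Sum>k<n + 1. X 1 * (edge_matrix n $$ (0, k) * x $ k)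
      - X (- 1) * (edge_matrix n $$ (1, k) * x $ k))"
    unfolding pairing_def using assms
    by (intro sum.cong) (auto simp: cartan_edge_matrix_0 left_diff_distrib mult.assoc)
  then show ?thesis
    using assms by (simp add: edge_matrix_mult_vec sum_subtractf sum_distrib_left
        del: index_mult_mat_vec sum.lessThan_Suc)
qed

lemma edge_matrix_simple_reflection:
  assumes x: "x \<in> carrier_vec (n + 1)" and j: "j \<le> n" and r: "r \<le> n"
  shows "(edge_matrix n *\<^sub>v (simple_reflection n laurent_var j *\<^sub>v x)) $ r =
    (edge_matrix n *\<^sub>v x) $ r - pairing n laurent_var j x * edge_matrix n $$ (r, j)"
proof -
  let ?S = "simple_reflection n laurent_var j"
  have "?S *\<^sub>v x \<in> carrier_vec (n + 1)"
    using x by (intro mult_mat_vec_carrier) auto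
  then have "(edge_matrix n *\<^sub>v (?S *\<^sub>v x)) $ r =
      (\<Sum>k<n + 1. edge_matrix n $$ (r, k) * (?S *\<^sub>v x) $ k)"
    using r by (rule edge_matrix_mult_vec)
  also have "\<dots> = (\<Sum>k<n + 1. edge_matrix n $$ (r, k) * x $ k -
      (if k = j then pairing n laurent_var j x * edge_matrix n $$ (r, j) else 0))"
    by (intro sum.cong)
      (auto simp: simple_reflection_mult_vec[OF x] algebra_simps simp del: index_mult_mat_vec)
  also have "\<dots> = (edge_matrix n *\<^sub>v x) $ r - pairing n laurent_var j x * edge_matrix n $$ (r, j)"
    using j r x by (simp add: sum_subtractf edge_matrix_mult_vec del: index_mult_mat_vec sum.lessThan_Suc)
  finally show ?thesis .
qed

text \<open>Exponents are shifted by even numbers, hence parity is kept. The value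
  \<open>k = 1\<close> serves the reflection in \<open>alpha_0\<close> and \<open>k = 0\<close> all
  others.\<close>

lemma is_edge_transpose:
  assumes f: "is_edge N f" and s: "s < N" "t < N" "s \<noteq> t"
    and g: "\<And>r. r < N \<Longrightarrow>
      g r = (if r = s then X (- (2 * k)) * f t else if r = t then X (2 * k) * f s else f r)"
  shows "is_edge N g"
proof -
  from f obtain p q a b where e: "p < N" "q < N" "p \<noteq> q" "even (a - b)"
      and f: "\<And>i. i < N \<Longrightarrow> f i = edge p q a b i"
    unfolding is_edge_def by blast
  \<comment> \<open>\<open>\<sigma>\<close> moves the ends of the edge, and \<open>\<delta>\<close>
    is the shift that the exponent at an end receives.\<close>
  define \<sigma> where "\<sigma> p = (if p = s then t else if p = t then s else p)" for p
  define \<delta> where "\<delta> p = (if p = s then 2 * k else if p = t then - (2 * k) else 0)" for p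
  have "\<sigma> p < N" "\<sigma> q < N" "\<sigma> p \<noteq> \<sigma> q" using e s by (auto simp: \<sigma>_def)
  moreover have "even (a + \<delta> p - (b + \<delta> q))" using e(4) by (auto simp: \<delta>_def)
  moreover have "\<forall>r<N. g r = edge (\<sigma> p) (\<sigma> q) (a + \<delta> p) (b + \<delta> q) r"
    using e s by (auto simp: g f edge_def \<sigma>_def \<delta>_def X_mult algebra_simps)
  ultimately show ?thesis unfolding is_edge_def by blast
qed

lemma root_is_edge:
  assumes n: "n \<ge> 2" and x: "x \<in> roots n laurent_var"
  shows "is_edge (n + 1) (\<lambda>r. (edge_matrix n *\<^sub>v x) $ r)"
  using x
proof (induction rule: roots_induct)
  case (simple i)
  have col: "(edge_matrix n *\<^sub>v simple_root n i) $ r = edge_matrix n $$ (r, i)" if "r < n + 1" for r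
    using simple that by (subst mat_mult_simple_root) auto
  show ?case
  proof (cases "i = 0")
    case True
    have "\<forall>r<n + 1. (edge_matrix n *\<^sub>v simple_root n i) $ r = edge 0 1 (- 1) 1 r"
      using col True by (auto simp: edge_matrix_index simp del: index_mult_mat_vec)
    moreover have "even (- 1 - 1 :: int)" by simp
    ultimately show ?thesis unfolding is_edge_def using n
      by (intro exI[of _ 0] exI[of _ 1] exI[of _ "- 1"] exI[of _ 1]) auto
  next
    case False
    have "\<forall>r<n + 1. (edge_matrix n *\<^sub>v simple_root n i) $ r = edge i (next_vertex n i) 0 0 r"
      using False simple by (auto simp: col edge_matrix_index simp del: index_mult_mat_vec)
    then show ?thesis unfolding is_edge_def using n simple False
      by (intro exI[of _ i] exI[of _ "next_vertex n i"] exI[of _ 0])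
        (auto simp: next_vertex_def simp del: index_mult_mat_vec)
  qed
next
  case (reflection x j)
  show ?case
  proof (cases "j = 0")
    case True
    show ?thesis
      by (rule is_edge_transpose[OF reflection(3), of 0 1 _ 1])
        (use n reflection(1) True in \<open>auto simp: edge_matrix_simple_reflection pairing_edge_matrix_0
          edge_matrix_index edge_def algebra_simps X_mult X_mult_left simp del: index_mult_mat_vec\<close>)
  next
    case False
    show ?thesis
      by (rule is_edge_transpose[OF reflection(3), of j "next_vertex n j" _ 0])
        (use n reflection(1,2) False in \<open>auto simp: edge_matrix_simple_reflection pairing_edge_matrix
          edge_matrix_index edge_def next_vertex_def simp del: index_mult_mat_vec\<close>)
  qed
qed

text \<open>Row 0 meets only the columns of \<open>alpha_0\<close> and \<open>alpha_n\<close>, and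
  both minors are triangular.\<close>

lemma det_edge_matrix:
  assumes n: "n \<ge> 2"
  shows "det (edge_matrix n) = X (- 1) - X 1"
proof -
  let ?E = "edge_matrix n"
  have "det ?E = (\<Sum>j<n + 1. ?E $$ (0, j) * cofactor ?E 0 j)"
    by (rule laplace_expansion_row) auto
  also have "\<dots> = (\<Sum>j\<in>{0, n}. ?E $$ (0, j) * cofactor ?E 0 j)"
    by (rule sum.mono_neutral_right) (auto simp: edge_matrix_def edge_def next_vertex_def)
  also have "\<dots> = X (- 1) * cofactor ?E 0 0 - cofactor ?E 0 n"
    using n by (simp add: edge_matrix_def edge_def next_vertex_def)
  also have "cofactor ?E 0 0 = 1"
  proof -
    have "det (mat_delete ?E 0 0) = prod_list (diag_mat (mat_delete ?E 0 0))"
      by (rule det_lower_triangular[of n])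
        (auto simp: mat_delete_def edge_matrix_def edge_def next_vertex_def)
    also have "\<dots> = 1"
      by (subst prod_list_diag_prod, rule prod.neutral)
        (auto simp: mat_delete_def edge_matrix_def edge_def next_vertex_def)
    finally show ?thesis by (simp add: cofactor_def)
  qed
  also have "cofactor ?E 0 n = X 1"
  proof -
    have "det (mat_delete ?E 0 n) = prod_list (diag_mat (mat_delete ?E 0 n))"
      by (rule det_upper_triangular[of _ n])
        (auto simp: mat_delete_def edge_matrix_def edge_def next_vertex_def)
    \<comment> \<open>Without row 0 and column \<open>n\<close> the diagonal holds the negative ends
      of the edges: \<open>- X 1\<close> from \<open>alpha_0\<close> and \<open>- 1\<close> from the
      others.\<close>
    also have "\<dots> = (\<Prod>i\<in>{0..<n}. if i = 0 then - X 1 else - 1)"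
      by (subst prod_list_diag_prod, rule prod.cong)
        (auto simp: mat_delete_def edge_matrix_def edge_def next_vertex_def)
    also have "\<dots> = - X 1 * (- 1) ^ (n - 1)"
      using n by (subst prod.atLeast_Suc_lessThan) auto
    also have "\<dots> = (- 1) ^ n * X 1"
      using n by (cases n) auto
    finally show ?thesis by (simp add: cofactor_def flip: mult.assoc power_add)
  qed
  finally show ?thesis by simp
qed

lemma root_det_edges:
  assumes n: "n \<ge> 2" and \<gamma>: "\<And>j. j \<le> n \<Longrightarrow> \<gamma> j \<in> roots n laurent_var"
  shows "(X (- 1) - X 1) * root_det n \<gamma> =
    det (mat (n + 1) (n + 1) (\<lambda>(i, j). (edge_matrix n *\<^sub>v \<gamma> j) $ i))"
proof -
  let ?M = "mat_of_cols (n + 1) (map \<gamma> [0..<n + 1])"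
  have M: "?M \<in> carrier_mat (n + 1) (n + 1)" by (simp add: carrier_matI)
  have "edge_matrix n * ?M = mat (n + 1) (n + 1) (\<lambda>(i, j). (edge_matrix n *\<^sub>v \<gamma> j) $ i)"
  proof (rule eq_matI)
    fix i j
    assume "i < dim_row (mat (n + 1) (n + 1) (\<lambda>(i, j). (edge_matrix n *\<^sub>v \<gamma> j) $ i))"
      and "j < dim_col (mat (n + 1) (n + 1) (\<lambda>(i, j). (edge_matrix n *\<^sub>v \<gamma> j) $ i))"
    then have ij: "i < n + 1" "j < n + 1" by simp_all
    then have "col ?M j = \<gamma> j"
      using roots_carrier[OF \<gamma>[of j]] by (subst col_mat_of_cols) (simp_all del: upt_Suc)
    with ij M show "(edge_matrix n * ?M) $$ (i, j) =
        mat (n + 1) (n + 1) (\<lambda>(i, j). (edge_matrix n *\<^sub>v \<gamma> j) $ i) $$ (i, j)"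
      by simp
  qed simp_all
  then show ?thesis
    using det_mult[OF edge_matrix_carrier(1) M] det_edge_matrix[OF n] by (simp add: root_det_def del: upt_Suc)
qed

subsection \<open>Specialization of the indeterminate\<close>

definition laurent_eval :: "real \<Rightarrow> laurent_poly \<Rightarrow> real"
  where "laurent_eval x p = (\<Sum>k\<in>Poly_Mapping.keys p. Poly_Mapping.lookup p k * x powi k)"

lemma laurent_eval_superset:
  assumes "finite S" "Poly_Mapping.keys p \<subseteq> S"
  shows "laurent_eval x p = (\<Sum>k\<in>S. Poly_Mapping.lookup p k * x powi k)"
  unfolding laurent_eval_def using assms
  by (intro sum.mono_neutral_left) (auto simp: in_keys_iff)

lemma laurent_eval_add: "laurent_eval x (p + q) = laurent_eval x p + laurent_eval x q"
proof -
  let ?S = "Poly_Mapping.keys p \<union> Poly_Mapping.keys q"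
  have "Poly_Mapping.keys (p + q) \<subseteq> ?S" by (rule keys_add)
  then show ?thesis
    by (simp add: laurent_eval_superset[of ?S] lookup_add distrib_right sum.distrib)
qed

lemma laurent_eval_single [simp]: "laurent_eval x (Poly_Mapping.single k c) = c * x powi k"
  by (simp add: laurent_eval_superset[of "{k}"])

lemma laurent_eval_0 [simp]: "laurent_eval x 0 = 0"
  by (simp add: laurent_eval_def)

lemma laurent_eval_sum: "laurent_eval x (sum f S) = (\<Sum>s\<in>S. laurent_eval x (f s))"
  by (induction S rule: infinite_finite_induct) (simp_all add: laurent_eval_add)

lemma laurent_sum_singles:
  "p = (\<Sum>k\<in>Poly_Mapping.keys p. Poly_Mapping.single k (Poly_Mapping.lookup p k))" for p :: laurent_poly
  by (rule poly_mapping_eqI)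
    (simp add: lookup_sum lookup_single when_def in_keys_iff)

lemma laurent_eval_mult:
  assumes "x \<noteq> 0"
  shows "laurent_eval x (p * q) = laurent_eval x p * laurent_eval x q"
proof -
  let ?P = "Poly_Mapping.keys p" and ?Q = "Poly_Mapping.keys q"
  have "p * q = (\<Sum>k\<in>?P. \<Sum>l\<in>?Q.
      Poly_Mapping.single (k + l) (Poly_Mapping.lookup p k * Poly_Mapping.lookup q l))"
    by (subst laurent_sum_singles[of p], subst laurent_sum_singles[of q])
      (simp add: sum_product mult_single)
  then show ?thesis
    using assms
    by (simp add: laurent_eval_sum power_int_add laurent_eval_def[of x p] laurent_eval_def[of x q]
      sum_product mult_ac)
qed

lemma comm_ring_hom_laurent_eval:
  assumes "x \<noteq> 0"
  shows "comm_ring_hom (laurent_eval x)"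
proof
  show "laurent_eval x 1 = 1"
    using laurent_eval_single[of x 0 1] by simp
qed (simp_all add: laurent_eval_add laurent_eval_mult assms)

lemma laurent_eval_X: "x \<noteq> 0 \<Longrightarrow> laurent_eval x (X k) = zpow x k"
  by (simp add: zpow_laurent_var zpow_field)

lemma laurent_eval_var [simp]: "laurent_eval x laurent_var = x"
  by (simp add: laurent_var_def)

lemma laurent_var_neq_1: "laurent_var \<noteq> 1"
  using X_inject[of 1 0] by (simp add: X_1)

text \<open>Multiplication by \<open>v - v^-1\<close> makes the sum telescope. The sum formula can
  also be specialized at \<open>v = 1\<close>, where the denominator of the quotient
  vanishes.\<close>

lemma c_coeff_mult: "c_coeff laurent_var (int m) * (laurent_var - X (- 1)) = X (int m) - X (- int m)"
  and c_coeff_sum: "c_coeff laurent_var (int m) = (\<Sum>i<m. X (int m - 1 - 2 * int i))"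
proof -
  define f where "f i = X (int m - 2 * int i)" for i
  have "(\<Sum>i<m. X (int m - 1 - 2 * int i)) * (laurent_var - X (- 1)) = (\<Sum>i<m. f i - f (Suc i))"
    unfolding sum_distrib_right f_def
    by (intro sum.cong) (simp_all add: right_diff_distrib X_1_mult X_mult algebra_simps)
  also have "\<dots> = f 0 - f m"
    by (rule sum_lessThan_telescope')
  also have "\<dots> = X (int m) - X (- int m)"
    by (simp add: f_def)
  finally have *: "(\<Sum>i<m. X (int m - 1 - 2 * int i)) * (laurent_var - X (- 1)) =
    X (int m) - X (- int m)" .
  have "laurent_var - X (- 1) \<noteq> 0"
    by (metis X_1 X_inject eq_iff_diff_eq_0 one_neq_neg_one)
  from quot_eqI[OF this *]
  show "c_coeff laurent_var (int m) = (\<Sum>i<m. X (int m - 1 - 2 * int i))"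
    by (simp add: c_coeff_def laurent_var_neq_1)
  with * show "c_coeff laurent_var (int m) * (laurent_var - X (- 1)) = X (int m) - X (- int m)"
    by simp
qed

text \<open>At \<open>x = 1\<close> each of the \<open>m\<close> summands becomes 1. Otherwise
  \<open>x > 0\<close> excludes \<open>x = -1\<close>, so \<open>x - x^-1\<close> is nonzero and the
  product identity determines the quotient.\<close>

lemma laurent_eval_c_coeff:
  assumes x: "x > 0" and k: "k > 0"
  shows "laurent_eval x (c_coeff laurent_var k) = c_coeff x k"
proof -
  from k obtain m where m: "k = int m" by (metis less_imp_le zero_le_imp_eq_int)
  interpret comm_ring_hom "laurent_eval x" by (rule comm_ring_hom_laurent_eval) (use x in simp)
  have X: "laurent_eval x (X l) = zpow x l" for l
    using x by (simp add: laurent_eval_X)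
  show ?thesis
  proof (cases "x = 1")
    case True
    have "laurent_eval x (X l) = 1" for l
      by (simp add: True zpow_laurent_var)
    then have "laurent_eval x (c_coeff laurent_var k) = (\<Sum>i<m. 1)"
      by (simp only: m c_coeff_sum laurent_eval_sum)
    with True show ?thesis by (simp add: m c_coeff_def)
  next
    case False
    have "x - zpow x (- 1) \<noteq> 0"
    proof
      assume "x - zpow x (- 1) = 0"
      then have "x * x = 1" using x by (simp add: zpow_field power_int_minus field_simps)
      then show False using x False by (auto simp: square_eq_1_iff)
    qed
    moreover have "laurent_eval x (c_coeff laurent_var k) * (x - zpow x (- 1)) = zpow x k - zpow x (- k)"
      using arg_cong[OF c_coeff_mult[of m], of "laurent_eval x"]
      by (simp add: m hom_mult hom_minus X)
    ultimately have "laurent_eval x (c_coeff laurent_var k) =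
        quot (zpow x k - zpow x (- k)) (x - zpow x (- 1))"
      by (intro quot_eqI[symmetric])
    also have "\<dots> = c_coeff x k"
      using False by (simp add: c_coeff_def)
    finally show ?thesis .
  qed
qed

lemma has_det_form_laurent_eval:
  assumes x: "x > 0" and d: "has_det_form laurent_var m d"
  shows "has_det_form x m (laurent_eval x d)"
proof -
  interpret comm_ring_hom "laurent_eval x" by (rule comm_ring_hom_laurent_eval) (use x in simp)
  from d obtain \<mu> l h where \<mu>: "\<mu> \<in> {1, - 1}" and h: "\<And>k. k \<in> {1..m} \<Longrightarrow> h k > 0"
    and d: "d = \<mu> * X l * (laurent_var - X (- 1)) ^ (m - 1) * (\<Prod>k = 1..m. c_coeff laurent_var (h k))"
    unfolding has_det_form_def by blast
  have "(\<Prod>k = 1..m. laurent_eval x (c_coeff laurent_var (h k))) = (\<Prod>k = 1..m. c_coeff x (h k))"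
    using x h by (intro prod.cong laurent_eval_c_coeff) auto
  then have "laurent_eval x d = laurent_eval x \<mu> * zpow x l * (x - zpow x (- 1)) ^ (m - 1) *
      (\<Prod>k = 1..m. c_coeff x (h k))"
    using x by (simp add: d hom_distribs laurent_eval_X)
  moreover have "laurent_eval x \<mu> \<in> {1, - 1}" using \<mu> by (auto simp: hom_uminus)
  ultimately show ?thesis unfolding has_det_form_def using h by blast
qed

section \<open>Specialization of roots and of their determinants\<close>

lemma map_vec_simple_root:
  assumes "x \<noteq> 0"
  shows "map_vec (laurent_eval x) (simple_root n i) = simple_root n i"
proof -
  interpret comm_ring_hom "laurent_eval x" by (rule comm_ring_hom_laurent_eval) fact
  show ?thesis by (rule eq_vecI) (auto simp: simple_root_def unit_vec_def)
qed

lemma laurent_eval_cartan: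
  assumes "x \<noteq> 0"
  shows "laurent_eval x (cartan n laurent_var i j) = cartan n x i j"
proof -
  interpret comm_ring_hom "laurent_eval x" by (rule comm_ring_hom_laurent_eval) fact
  have "laurent_eval x 2 = 2" using hom_add[of 1 1] by simp
  then show ?thesis using assms by (simp add: cartan_def hom_uminus laurent_eval_X)
qed

lemma map_mat_simple_reflection:
  assumes "x \<noteq> 0"
  shows "map_mat (laurent_eval x) (simple_reflection n laurent_var j) = simple_reflection n x j"
proof -
  interpret comm_ring_hom "laurent_eval x" by (rule comm_ring_hom_laurent_eval) fact
  show ?thesis
    by (rule eq_matI)
      (auto simp: simple_reflection_index hom_minus laurent_eval_cartan assms)
qed

lemma map_vec_simple_reflection:
  assumes "x \<noteq> 0" "y \<in> carrier_vec (n + 1)"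
  shows "map_vec (laurent_eval x) (simple_reflection n laurent_var j *\<^sub>v y) =
    simple_reflection n x j *\<^sub>v map_vec (laurent_eval x) y"
proof -
  interpret comm_ring_hom "laurent_eval x" by (rule comm_ring_hom_laurent_eval) fact
  show ?thesis
    using mult_mat_vec_hom[OF simple_reflection_carrier(1) assms(2)] map_mat_simple_reflection[OF assms(1)]
    by metis
qed

lemma map_vec_root:
  assumes x: "x \<noteq> 0" and y: "y \<in> roots n laurent_var"
  shows "map_vec (laurent_eval x) y \<in> roots n x"
  using y
proof (induction rule: roots_induct)
  case (simple i)
  then show ?case by (simp add: map_vec_simple_root x simple_root_in_roots)
next
  case (reflection y j)
  then show ?case by (simp add: map_vec_simple_reflection x reflection_in_roots)
qed

text \<open>Reflections commute with evaluation, so a real root is lifted by repeating its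
  reflections over the Laurent polynomials.\<close>

lemma root_lift:
  assumes x: "x \<noteq> 0" and y: "y \<in> roots n x"
  shows "\<exists>z\<in>roots n laurent_var. map_vec (laurent_eval x) z = y"
  using y
proof (induction rule: roots_induct)
  case (simple i)
  then show ?case using map_vec_simple_root[OF x] simple_root_in_roots by blast
next
  case (reflection y j)
  then obtain z where z: "z \<in> roots n laurent_var" "map_vec (laurent_eval x) z = y" by blast
  with reflection(2) map_vec_simple_reflection[OF x roots_carrier[OF z(1)], of j]
  show ?case using reflection_in_roots by metis
qed

lemma root_det_laurent_eval:
  assumes x: "x \<noteq> 0" and z: "\<And>j. j \<le> n \<Longrightarrow> z j \<in> roots n laurent_var"
    and y: "\<And>j. j \<le> n \<Longrightarrow> map_vec (laurent_eval x) (z j) = y j"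
  shows "root_det n y = laurent_eval x (root_det n z)"
proof -
  interpret comm_ring_hom "laurent_eval x" by (rule comm_ring_hom_laurent_eval) fact
  have "map y [0..<n + 1] = map (map_vec (laurent_eval x)) (map z [0..<n + 1])"
    using y by (auto simp del: upt_Suc)
  moreover have "set (map z [0..<n + 1]) \<subseteq> carrier_vec (n + 1)"
  proof
    fix w assume "w \<in> set (map z [0..<n + 1])"
    then obtain j where "j < n + 1" "w = z j" by (auto simp del: upt_Suc)
    then show "w \<in> carrier_vec (n + 1)" using roots_carrier[OF z] by simp
  qed
  ultimately show ?thesis
    unfolding root_det_def by (metis mat_of_cols_map hom_det)
qed

subsection \<open>The form of the determinant\<close>

text \<open>Every cycle factor splits as \<open>X h - X (- h) = (v - v^-1) c_h\<close>, and the
  powers of \<open>v - v^-1\<close> are collected in front.\<close>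

lemma cyc_form_product:
  assumes "cyc_form m x"
  shows "\<exists>\<mu>\<in>{1, - 1}. \<exists>l h. (\<forall>k\<in>{1..m}. h k > 0) \<and>
    x = \<mu> * X l * (laurent_var - X (- 1)) ^ m * (\<Prod>k = 1..m. c_coeff laurent_var (h k))"
  using assms
proof (induction rule: cyc_form.induct)
  case (unit \<mu> l)
  then show ?case by auto
next
  case (cycle g m x)
  then obtain \<mu> l h where \<mu>: "\<mu> \<in> {1, - 1}" and h: "\<forall>k\<in>{1..m}. h k > 0" and
    x: "x = \<mu> * X l * (laurent_var - X (- 1)) ^ m * (\<Prod>k = 1..m. c_coeff laurent_var (h k))"
    by blast
  let ?h = "h(Suc m := g)"
  have "(\<Prod>k = 1..m. c_coeff laurent_var (?h k)) = (\<Prod>k = 1..m. c_coeff laurent_var (h k))"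
    by (rule prod.cong) auto
  then have "(\<Prod>k = 1..Suc m. c_coeff laurent_var (?h k)) =
      (\<Prod>k = 1..m. c_coeff laurent_var (h k)) * c_coeff laurent_var g"
    by (simp add: prod.cl_ivl_Suc del: fun_upd_apply) simp
  moreover have "X g - X (- g) = c_coeff laurent_var g * (laurent_var - X (- 1))"
    using c_coeff_mult[of "nat g"] cycle(1) by simp
  ultimately have "(X g - X (- g)) * x = \<mu> * X l * (laurent_var - X (- 1)) ^ Suc m *
      (\<Prod>k = 1..Suc m. c_coeff laurent_var (?h k))"
    by (simp add: x mult_ac)
  moreover have "\<forall>k\<in>{1..Suc m}. ?h k > 0"
    using h cycle(1) by auto
  ultimately show ?case using \<mu> by blast
qed

text \<open>
  At \<open>v = 1\<close> the left factor vanishes, whereas a signed monomial does not; hence \<open>m \<noteq> 0\<close>.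
\<close>

lemma has_det_form_cancel:
  assumes c: "cyc_form m ((X (- 1) - X 1) * d)"
  shows "m \<ge> 1 \<and> has_det_form laurent_var m d"
proof -
  let ?v = "laurent_var - X (- 1)"
  from cyc_form_product[OF c] obtain \<mu> l h where \<mu>: "\<mu> \<in> {1, - 1}"
    and h: "\<forall>k\<in>{1..m}. h k > 0"
    and d: "(X (- 1) - X 1) * d = \<mu> * X l * ?v ^ m * (\<Prod>k = 1..m. c_coeff laurent_var (h k))"
    by blast
  interpret comm_ring_hom "laurent_eval 1" by (rule comm_ring_hom_laurent_eval) simp
  have "m \<noteq> 0"
  proof
    assume "m = 0"
    with d have "laurent_eval 1 ((X (- 1) - X 1) * d) = laurent_eval 1 (\<mu> * X l)" by simp
    moreover have "laurent_eval 1 (X k) = 1" for k by (simp add: zpow_laurent_var)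
    ultimately show False using \<mu> by (auto simp: hom_mult hom_minus hom_uminus)
  qed
  then obtain m' where m: "m = Suc m'" by (cases m) auto
  let ?P = "\<Prod>k = 1..m. c_coeff laurent_var (h k)"
  have "?v * d = - ((X (- 1) - X 1) * d)"
    by (simp only: X_1 minus_mult_left minus_diff_eq)
  also have "\<dots> = - (\<mu> * X l * ?v ^ m * ?P)"
    by (simp only: d)
  also have "\<dots> = ?v * ((- \<mu>) * X l * ?v ^ m' * ?P)"
    unfolding m power_Suc by (simp only: mult_minus_left mult_minus_right mult_ac)
  finally have "?v * d = ?v * ((- \<mu>) * X l * ?v ^ m' * ?P)" .
  moreover have "?v \<noteq> 0"
    by (metis X_1 X_inject eq_iff_diff_eq_0 one_neq_neg_one)
  ultimately have "d = (- \<mu>) * X l * ?v ^ (m - 1) * (\<Prod>k = 1..m. c_coeff laurent_var (h k))"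
    by (metis m diff_Suc_1 mult_left_cancel)
  moreover have "- \<mu> \<in> {1, - 1}" using \<mu> by auto
  ultimately have "has_det_form laurent_var m d" unfolding has_det_form_def using h by blast
  with m show ?thesis by simp
qed

text \<open>The determinant of the edges is \<open>X (- 1) - X 1\<close> times that of the roots,
  and cancelling this factor leaves the exponent \<open>m - 1\<close>. For \<open>n = 2\<close> the
  bound of one cycle meets \<open>m >= 1\<close> from the cancellation.\<close>

lemma root_det_laurent:
  assumes n: "n \<ge> 2" and \<gamma>: "\<And>j. j \<le> n \<Longrightarrow> \<gamma> j \<in> roots n laurent_var"
    and d: "root_det n \<gamma> \<noteq> 0"
  shows "\<exists>m\<ge>1. has_det_form laurent_var m (root_det n \<gamma>)"
    and "n = 2 \<Longrightarrow> has_det_form laurent_var 1 (root_det n \<gamma>)"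
proof -
  let ?c = "\<lambda>j i. (edge_matrix n *\<^sub>v \<gamma> j) $ i"
  let ?D = "det (mat (n + 1) (n + 1) (\<lambda>(i, j). ?c j i))"
  have e: "is_edge (n + 1) (?c j)" if "j < n + 1" for j
    using root_is_edge[OF n \<gamma>] that by simp
  have D: "?D = (X (- 1) - X 1) * root_det n \<gamma>"
    using root_det_edges[OF n \<gamma>] by simp
  have "?D \<noteq> 0" unfolding D using d by simp
  moreover have "cyc_form0 ?D"
    using e by (intro det_edges_spokes) blast
  ultimately obtain m where "cyc_form m ?D"
    by (auto simp: cyc_form0_def cyc_form_le_def)
  then show "\<exists>m\<ge>1. has_det_form laurent_var m (root_det n \<gamma>)"
    using has_det_form_cancel unfolding D by blast
  show "has_det_form laurent_var 1 (root_det n \<gamma>)" if 2: "n = 2"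
  proof -
    have 3: "n + 1 = 3" using 2 by simp
    have "cyc_form_le 1 ?D"
      unfolding 3 by (rule det_edges_3) (use e 3 in simp)
    with \<open>?D \<noteq> 0\<close> obtain m where "m \<le> 1" "cyc_form m ?D"
      by (auto simp: cyc_form_le_def)
    moreover from has_det_form_cancel[of m "root_det n \<gamma>"] this(2)
    have "m \<ge> 1 \<and> has_det_form laurent_var m (root_det n \<gamma>)"
      unfolding D by blast
    ultimately show ?thesis by (metis le_antisym)
  qed
qed

subsection \<open>Roots with two disjoint cycles\<close>

lemma pairing_interior:
  assumes "n \<ge> 2" "1 \<le> j" "j < n"
  shows "pairing n v j x =
    2 * x $ j - x $ (j + 1) + cartan n v (j - 1) j * x $ (j - 1)"
proof -
  have "pairing n v j x = (\<Sum>k\<in>{j - 1, j, j + 1}. cartan n v k j * x $ k)"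
    unfolding pairing_def using assms
    by (intro sum.mono_neutral_right) (auto simp: cartan_def)
  also have "\<dots> = cartan n v (j - 1) j * x $ (j - 1) + (cartan n v j j * x $ j
      + cartan n v (j + 1) j * x $ (j + 1))"
    using assms by (subst sum.insert) auto
  also have "cartan n v j j = 2" by (simp add: cartan_def)
  also have "cartan n v (j + 1) j = - 1" using assms by (auto simp: cartan_def)
  finally show ?thesis by simp
qed

text \<open>Applying \<open>s_1, ..., s_j\<close> to \<open>alpha_0\<close> in turn adds
  \<open>v alpha_i\<close> at each step, as the pairing is always \<open>- v\<close>. In edge
  coordinates the result is \<open>v^-1 e_0 - v e_(j+1)\<close>.\<close>

lemma root_chain:
  assumes n: "n \<ge> 2" and j: "j < n"
  shows "vec (n + 1) (\<lambda>i. if i = 0 then 1 else if i \<le> j then v else 0) \<in> roots n v"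
    (is "?B j \<in> _")
  using j
proof (induction j)
  case 0
  have B: "?B 0 = simple_root n 0"
    by (rule eq_vecI) (auto simp: simple_root_def unit_vec_def)
  show ?case unfolding B by (rule simple_root_in_roots) simp
next
  case (Suc j)
  define C where "C = ?B j"
  have C: "C \<in> carrier_vec (n + 1)"
    and C_index: "\<And>i. i < n + 1 \<Longrightarrow> C $ i = (if i = 0 then 1 else if i \<le> j then v else 0)"
    by (simp_all add: C_def)
  have "pairing n v (Suc j) C = - v"
    using Suc.prems n by (subst pairing_interior) (auto simp: C_index cartan_def)
  then have "simple_reflection n v (Suc j) *\<^sub>v C = ?B (Suc j)"
    using Suc.prems by (intro eq_vecI)
      (auto simp: simple_reflection_mult_vec[OF C] C_index simp del: index_mult_mat_vec)
  moreover have "C \<in> roots n v" using Suc by (simp add: C_def)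
  ultimately show ?case
    using reflection_in_roots[of C n v "Suc j"] Suc.prems by simp
qed

text \<open>This root is \<open>s_(n-1) s_n alpha_0\<close>, in edge coordinates
  \<open>v^-1 e_(n-1) - v e_1\<close>.\<close>

lemma root_closing_edge:
  assumes n: "n \<ge> 3"
  shows "vec (n + 1) (\<lambda>i. if i = 0 then 1 else if i \<ge> n - 1 then zpow v (- 1) else 0) \<in> roots n v"
    (is "?B \<in> _")
proof -
  define C where "C = simple_reflection n v n *\<^sub>v simple_root n 0"
  have C: "C = vec (n + 1) (\<lambda>i. if i = 0 then 1 else if i = n then zpow v (- 1) else 0)"
    unfolding C_def using n
    by (subst simple_reflection_simple_root)
      (auto intro!: eq_vecI simp: simple_root_def unit_vec_def cartan_def)
  then have C': "C \<in> carrier_vec (n + 1)"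
    and C_index: "\<And>i. i < n + 1 \<Longrightarrow> C $ i = (if i = 0 then 1 else if i = n then zpow v (- 1) else 0)"
    by simp_all
  have "pairing n v (n - 1) C = - zpow v (- 1)"
    using n by (subst pairing_interior) (auto simp: C_index cartan_def)
  then have "simple_reflection n v (n - 1) *\<^sub>v C = ?B"
    using n by (intro eq_vecI)
      (auto simp: simple_reflection_mult_vec[OF C'] C_index simp del: index_mult_mat_vec)
  moreover have "C \<in> roots n v"
    unfolding C_def by (intro reflection_in_roots simple_root_in_roots) auto
  ultimately show ?thesis
    using reflection_in_roots[of C n v "n - 1"] by simp
qed

text \<open>All columns except 0 and \<open>n - 1\<close> are unit vectors. Subtracting
  \<open>u\<close> times row 0 from row \<open>n - 1\<close> leaves the single entry
  \<open>w - u\<close> in that row, and its minor is unitriangular.\<close>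

lemma det_two_cycles:
  fixes u w :: "'a::comm_ring_1"
  assumes n: "n \<ge> 3"
  shows "det (mat (n + 1) (n + 1) (\<lambda>(i, j).
    if j = 0 then (if i = 0 then 1 else if i \<le> n - 1 then u else 0)
    else if j = n - 1 then (if i = 0 then 1 else if i \<ge> n - 1 then w else 0)
    else if i = j then 1 else 0)) = w - u"
    (is "det ?M = _")
proof -
  define A where "A = addrow (- u) (n - 1) 0 ?M"
  have A: "A \<in> carrier_mat (n + 1) (n + 1)" by (simp add: A_def mat_addrow_gen_def)
  have "det ?M = det A"
    unfolding A_def using n by (intro det_addrow[symmetric]) auto
  also have "\<dots> = (\<Sum>j<n + 1. A $$ (n - 1, j) * cofactor A (n - 1) j)"
    using A by (rule laplace_expansion_row) (use n in auto)
  also have "\<dots> = (\<Sum>j<n + 1. if j = n - 1 then (w - u) * cofactor A (n - 1) j else 0)"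
    using n by (intro sum.cong) (auto simp: A_def mat_addrow_gen_def)
  also have "\<dots> = (w - u) * cofactor A (n - 1) (n - 1)"
    by (simp del: sum.lessThan_Suc)
  also have "cofactor A (n - 1) (n - 1) = 1"
  proof -
    have "det (mat_delete A (n - 1) (n - 1)) = prod_list (diag_mat (mat_delete A (n - 1) (n - 1)))"
      by (rule det_lower_triangular[of n])
        (use n in \<open>auto simp: mat_delete_def A_def mat_addrow_gen_def\<close>)
    also have "\<dots> = 1"
      by (subst prod_list_diag_prod, rule prod.neutral)
        (use n in \<open>auto simp: mat_delete_def A_def mat_addrow_gen_def\<close>)
    finally show ?thesis by (simp add: cofactor_def)
  qed
  finally show ?thesis by simp
qed

lemma c_coeff_laurent_1: "c_coeff laurent_var 1 = 1"
  using c_coeff_sum[of 1] by simp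

text \<open>
  The edges \<open>{1, 2}, \<dots>, {n - 2, n - 1}\<close> are closed up by a multiple of the edge \<open>{n - 1, 1}\<close> and the
  edge \<open>{n, 0}\<close> is doubled, which gives two disjoint cycles.
\<close>

lemma exists_two_cycles:
  assumes n: "n \<ge> 3"
  shows "\<exists>\<gamma>. (\<forall>j\<le>n. \<gamma> j \<in> roots n laurent_var) \<and> has_det_form laurent_var 2 (root_det n \<gamma>)"
proof -
  let ?\<gamma> = "\<lambda>j. if j = 0 then vec (n + 1) (\<lambda>i. if i = 0 then 1 else if i \<le> n - 1 then laurent_var else 0)
    else if j = n - 1 then vec (n + 1) (\<lambda>i. if i = 0 then 1 else if i \<ge> n - 1 then X (- 1) else 0)
    else simple_root n j"
  have "\<forall>j\<le>n. ?\<gamma> j \<in> roots n laurent_var"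
    using root_chain[of n "n - 1" laurent_var] root_closing_edge[OF n, of laurent_var]
      simple_root_in_roots[of _ n laurent_var] n by auto
  moreover have "mat_of_cols (n + 1) (map ?\<gamma> [0..<n + 1]) = mat (n + 1) (n + 1) (\<lambda>(i, j).
    if j = 0 then (if i = 0 then 1 else if i \<le> n - 1 then laurent_var else 0)
    else if j = n - 1 then (if i = 0 then 1 else if i \<ge> n - 1 then X (- 1) else 0)
    else if i = j then 1 else 0)"
    by (rule eq_matI)
      (auto simp: mat_of_cols_index simple_root_def unit_vec_def simp del: upt_Suc)
  then have "root_det n ?\<gamma> = X (- 1) - laurent_var"
    unfolding root_det_def by (simp only: det_two_cycles[OF n])
  \<comment> \<open>As \<open>c_1 = 1\<close>, the value \<open>v^-1 - v\<close> is the form with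
    sign -1, \<open>l = 0\<close>, \<open>m = 2\<close> and \<open>h_1 = h_2 = 1\<close>.\<close>
  then have "root_det n ?\<gamma> = (- 1) * X 0 * (laurent_var - X (- 1)) ^ (2 - 1) *
      (\<Prod>k = 1..2::nat. c_coeff laurent_var 1)"
    by (simp add: c_coeff_laurent_1)
  then have "has_det_form laurent_var 2 (root_det n ?\<gamma>)"
    unfolding has_det_form_def
    by (intro bexI[of _ "- 1"] exI[of _ 0] exI[of _ "\<lambda>_. 1"] conjI) auto
  ultimately show ?thesis by (intro exI[of _ ?\<gamma>] conjI)
qed

theorem theorem4p13:
  fixes n :: nat
  assumes "n \<ge> 2"
  shows
    "(\<forall>v::real. v > 0 \<longrightarrow>
        (\<forall>\<gamma>. (\<forall>j \<le> n. \<gamma> j \<in> roots n v) \<longrightarrow>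
          (root_det n \<gamma> = 0 \<or> (\<exists>m \<ge> 1. has_det_form v m (root_det n \<gamma>))) \<and>
          (n = 2 \<and> root_det n \<gamma> \<noteq> 0 \<longrightarrow> has_det_form v 1 (root_det n \<gamma>))) \<and>
        (n \<ge> 3 \<longrightarrow>
          (\<exists>\<gamma>. (\<forall>j \<le> n. \<gamma> j \<in> roots n v) \<and>
            (\<exists>m > 1. has_det_form v m (root_det n \<gamma>))))) \<and>
     (\<forall>\<gamma>. (\<forall>j \<le> n. \<gamma> j \<in> roots n laurent_var) \<longrightarrow>
        (root_det n \<gamma> = 0 \<or> (\<exists>m \<ge> 1. has_det_form laurent_var m (root_det n \<gamma>))) \<and>
        (n = 2 \<and> root_det n \<gamma> \<noteq> 0 \<longrightarrow> has_det_form laurent_var 1 (root_det n \<gamma>))) \<and>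
     (n \<ge> 3 \<longrightarrow>
        (\<exists>\<gamma>. (\<forall>j \<le> n. \<gamma> j \<in> roots n laurent_var) \<and>
          (\<exists>m > 1. has_det_form laurent_var m (root_det n \<gamma>))))"
proof (intro conjI allI impI)
  fix v :: real and \<gamma>
  assume v: "v > 0" and \<gamma>: "\<forall>j\<le>n. \<gamma> j \<in> roots n v"
  \<comment> \<open>The given roots are lifted one by one, so that the generic case applies to the
    lifts.\<close>
  have "\<forall>j. \<exists>y. j \<le> n \<longrightarrow> y \<in> roots n laurent_var \<and> map_vec (laurent_eval v) y = \<gamma> j"
    using root_lift[of v _ n] v \<gamma> by blast
  then obtain z where "\<forall>j. j \<le> n \<longrightarrow> z j \<in> roots n laurent_var \<and> map_vec (laurent_eval v) (z j) = \<gamma> j"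
    by (rule choice[THEN exE])
  then have z: "\<And>j. j \<le> n \<Longrightarrow> z j \<in> roots n laurent_var"
    and z\<gamma>: "\<And>j. j \<le> n \<Longrightarrow> map_vec (laurent_eval v) (z j) = \<gamma> j"
    by blast+
  have det: "root_det n \<gamma> = laurent_eval v (root_det n z)"
    using v z z\<gamma> by (intro root_det_laurent_eval) auto
  show "root_det n \<gamma> = 0 \<or> (\<exists>m\<ge>1. has_det_form v m (root_det n \<gamma>))"
  proof (cases "root_det n z = 0")
    case False
    from root_det_laurent(1)[OF assms z False] show ?thesis
      unfolding det using has_det_form_laurent_eval[OF v] by blast
  qed (simp add: det)
  assume "n = 2 \<and> root_det n \<gamma> \<noteq> 0"
  then have "n = 2" "root_det n z \<noteq> 0" by (auto simp: det)
  from root_det_laurent(2)[OF assms z this(2) this(1)] show "has_det_form v 1 (root_det n \<gamma>)"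
    unfolding det by (rule has_det_form_laurent_eval[OF v])
next
  fix v :: real
  assume v: "v > 0" and n: "n \<ge> 3"
  from exists_two_cycles[OF n] obtain z where z: "\<And>j. j \<le> n \<Longrightarrow> z j \<in> roots n laurent_var"
    and d: "has_det_form laurent_var 2 (root_det n z)" by blast
  let ?\<gamma> = "\<lambda>j. map_vec (laurent_eval v) (z j)"
  have "\<forall>j\<le>n. ?\<gamma> j \<in> roots n v"
    using z map_vec_root v by simp
  \<comment> \<open>The form survives evaluation even at \<open>v = 1\<close>, where the factor
    \<open>v - v^-1\<close> makes the determinant 0.\<close>
  moreover have "has_det_form v 2 (root_det n ?\<gamma>)"
    using has_det_form_laurent_eval[OF v d] root_det_laurent_eval[of v n z ?\<gamma>] v z by simp
  ultimately show "\<exists>\<gamma>. (\<forall>j\<le>n. \<gamma> j \<in> roots n v) \<and> (\<exists>m>1. has_det_form v m (root_det n \<gamma>))"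
    by (intro exI[of _ ?\<gamma>] exI[of _ "2::nat"] conjI) simp_all
next
  fix \<gamma> :: "nat \<Rightarrow> laurent_poly vec"
  assume \<gamma>: "\<forall>j\<le>n. \<gamma> j \<in> roots n laurent_var"
  then show "root_det n \<gamma> = 0 \<or> (\<exists>m\<ge>1. has_det_form laurent_var m (root_det n \<gamma>))"
    using root_det_laurent(1)[OF assms, of \<gamma>] by blast
  assume "n = 2 \<and> root_det n \<gamma> \<noteq> 0"
  then show "has_det_form laurent_var 1 (root_det n \<gamma>)"
    using root_det_laurent(2)[OF assms, of \<gamma>] \<gamma> by blast
next
  assume "n \<ge> 3"
  from exists_two_cycles[OF this] obtain \<gamma> where "\<forall>j\<le>n. \<gamma> j \<in> roots n laurent_var"
    and "has_det_form laurent_var 2 (root_det n \<gamma>)" by blast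
  moreover have "(2::nat) > 1" by simp
  ultimately show "\<exists>\<gamma>. (\<forall>j\<le>n. \<gamma> j \<in> roots n laurent_var) \<and>
      (\<exists>m>1. has_det_form laurent_var m (root_det n \<gamma>))"
    by blast
qed

end
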